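(* Let $k\ge 2$, let $V$ be a finite set with $n:=|V|$, and let $\chi_0,\dots,\chi_\ell\colon V^k\to C$ be colorings such that (I) $\chi_t$ is shufflable and compatible with equality for all $t\in\{0,\dots,\ell\}$; (II) $\chi_t\preceq \chi_{t-1}'$ for all $t\in\{1,\dots,\ell\}$, where $\chi_{t-1}'$ is the $k$-WL refinement of $\chi_{t-1}$; (III) $\chi_t\prec\chi_{t-1}$ for all $t\in\{1,\dots,\ell\}$. Then $\ell\le 2n^{k-1}(\lceil k\log n\rceil+1)=O(kn^{k-1}\log n)$.
   Context: For colorings $\chi_1,\chi_2\colon V^k\to C$: $\chi_1\preceq\chi_2$ ($\chi_1$ refines $\chi_2$) if $\chi_1(\vec v)=\chi_1(\vec w)$ implies $\chi_2(\vec v)=\chi_2(\vec w)$; $\chi_1\equiv\chi_2$ if both $\chi_1\preceq\chi_2$ and $\chi_2\preceq\chi_1$; $\chi_1\prec\chi_2$ if $\chi_1\preceq\chi_2$ and $\chi_1\not\equiv\chi_2$. The $k$-WL refinement of $\chi$ is $\chi'(\vec v)=\big(\chi(\vec v),\{\!\{(\chi(\vec v[w/1]),\dots,\chi(\vec v[w/k]))\mid w\in V\}\!\}\big)$, where $\vec v[w/i]$ is $\vec v$ with its $i$-th entry replaced by $w$. A coloring is compatible with equality if whenever $(v_1,\dots,v_k),(w_1,\dots,w_k)$ have the same color, then for all $i,j\in[k]$: $v_i=v_j\iff w_i=w_j$. A coloring is shufflable if for every function $\pi\colon[k]\to[k]$ (not necessarily bijective) and all tuples of the same color $(v_1,\dots,v_k),(w_1,\dots,w_k)$,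 the tuples $(v_{\pi(1)},\dots,v_{\pi(k)})$ and $(w_{\pi(1)},\dots,w_{\pi(k)})$ also have the same color. $\log$ is base 2. *)

theory Defs
  imports Complex_Main "HOL-Library.Multiset" "HOL-Library.FuncSet" "HOL-Library.NList"
    "HOL-Library.Landau_Symbols"
begin

text \<open>
  Elements of \<open>V\<^sup>k\<close> are lists in \<^term>\<open>nlists k V\<close>, with positions \<open>0, \<dots>, k - 1\<close> in place of
  \<open>1, \<dots>, k\<close>. A coloring is a function on lists of which only the values on
  \<^term>\<open>nlists k V\<close> matter. The two color types may differ in \<open>refines\<close>, since the
  k-WL refinement of a coloring takes its values in a new set of colors.
\<close>

definition refines ::
    "'a set \<Rightarrow> nat \<Rightarrow> ('a list \<Rightarrow> 'c) \<Rightarrow> ('a list \<Rightarrow> 'd) \<Rightarrow> bool" where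
  "refines V k \<chi>\<^sub>1 \<chi>\<^sub>2 \<longleftrightarrow>
     (\<forall>v \<in> nlists k V. \<forall>w \<in> nlists k V. \<chi>\<^sub>1 v = \<chi>\<^sub>1 w \<longrightarrow> \<chi>\<^sub>2 v = \<chi>\<^sub>2 w)"

definition equivalent_colorings ::
    "'a set \<Rightarrow> nat \<Rightarrow> ('a list \<Rightarrow> 'c) \<Rightarrow> ('a list \<Rightarrow> 'd) \<Rightarrow> bool" where
  "equivalent_colorings V k \<chi>\<^sub>1 \<chi>\<^sub>2 \<longleftrightarrow> refines V k \<chi>\<^sub>1 \<chi>\<^sub>2 \<and> refines V k \<chi>\<^sub>2 \<chi>\<^sub>1"

definition strictly_refines ::
    "'a set \<Rightarrow> nat \<Rightarrow> ('a list \<Rightarrow> 'c) \<Rightarrow> ('a list \<Rightarrow> 'd) \<Rightarrow> bool" where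
  "strictly_refines V k \<chi>\<^sub>1 \<chi>\<^sub>2 \<longleftrightarrow>
     refines V k \<chi>\<^sub>1 \<chi>\<^sub>2 \<and> \<not> equivalent_colorings V k \<chi>\<^sub>1 \<chi>\<^sub>2"

definition wl_refinement ::
    "'a set \<Rightarrow> nat \<Rightarrow> ('a list \<Rightarrow> 'c) \<Rightarrow> 'a list \<Rightarrow> 'c \<times> 'c list multiset" where
  "wl_refinement V k \<chi> v =
     (\<chi> v, image_mset (\<lambda>w. map (\<lambda>i. \<chi> (v[i := w])) [0..<k]) (mset_set V))"

definition compatible_with_equality ::
    "'a set \<Rightarrow> nat \<Rightarrow> ('a list \<Rightarrow> 'c) \<Rightarrow> bool" where
  "compatible_with_equality V k \<chi> \<longleftrightarrow>
     (\<forall>v \<in> nlists k V. \<forall>w \<in> nlists k V. \<chi> v = \<chi> w \<longrightarrow>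
        (\<forall>i<k. \<forall>j<k. v ! i = v ! j \<longleftrightarrow> w ! i = w ! j))"

definition shufflable :: "'a set \<Rightarrow> nat \<Rightarrow> ('a list \<Rightarrow> 'c) \<Rightarrow> bool" where
  "shufflable V k \<chi> \<longleftrightarrow>
     (\<forall>\<pi> \<in> {..<k} \<rightarrow> {..<k}. \<forall>v \<in> nlists k V. \<forall>w \<in> nlists k V. \<chi> v = \<chi> w \<longrightarrow>
        \<chi> (map (\<lambda>i. v ! \<pi> i) [0..<k]) = \<chi> (map (\<lambda>i. w ! \<pi> i) [0..<k]))"

end

theory Submission
  imports Defs "HOL-Library.Function_Algebras"
    "HOL-Computational_Algebra.Fundamental_Theorem_Algebra"
begin

text \<open>
  Let \<open>S\<^sub>t\<close> be the space of complex matrices indexed by \<open>V\<^sup>k\<^sup>-\<^sup>1\<close> whose entry at \<open>(ua, ub)\<close>, for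
  \<open>u \<in> V\<^sup>k\<^sup>-\<^sup>2\<close>, depends only on \<open>\<chi>\<^sub>t(uab)\<close>, all other entries being 0. Compatibility with equality puts
  the identity into \<open>S\<^sub>t\<close>, shufflability makes \<open>S\<^sub>t\<close> closed under conjugate transposition, and
  (II), (III) give \<open>S\<^sub>t S\<^sub>t \<subseteq> S\<^sub>t\<^sub>+\<^sub>1\<close> and \<open>S\<^sub>t \<subset> S\<^sub>t\<^sub>+\<^sub>1\<close>. The algebra generated by \<open>S\<^sub>t\<close> has
  dimension at most \<open>n\<^sup>k\<close>, so it is spanned by words of length at most \<open>n\<^sup>k\<close> and hence is contained
  in \<open>S\<^sub>t\<^sub>+\<^sub>L\<close> for \<open>L = \<lceil>k log n\<rceil>\<close>. Thus every \<open>L + 1\<close> steps this algebra grows strictly.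

  A strict chain of unital *-subalgebras of the \<open>N \<times> N\<close> matrices has fewer than \<open>2N\<close> steps: decompose
  the identity into \<open>r \<le> N\<close> minimal orthogonal projections of \<open>B\<close>, and call \<open>p\<close> and \<open>q\<close> linked if
  \<open>p B q \<noteq> 0\<close>, an equivalence relation with \<open>s\<close> classes. Passing to a larger algebra and
  refining the projections there, neither \<open>r\<close> nor \<open>r - s\<close> decreases, and one of them increases.
\<close>

subsection \<open>Star algebras\<close>

text \<open>The unit laws and positivity are required on \<open>carrier\<close> only: matrices will
  be functions on all index pairs, while their product sums over a fixed index set. \<open>D\<close>
  bounds dimensions and \<open>N\<close> bounds the size of families of orthogonal
  idempotents.\<close>

locale star_algebra = vector_space scale
  for scale :: "complex \<Rightarrow> 'r::ab_group_add \<Rightarrow> 'r" (infixr \<open>*s\<close> 75) +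
  fixes mult :: "'r \<Rightarrow> 'r \<Rightarrow> 'r" (infixl \<open>\<odot>\<close> 70)
    and star :: "'r \<Rightarrow> 'r" and e :: 'r and carrier :: "'r set" and D N :: nat
  assumes mult_assoc: "(a \<odot> b) \<odot> c = a \<odot> (b \<odot> c)"
    and mult_add_left: "(a + b) \<odot> c = a \<odot> c + b \<odot> c"
    and mult_add_right: "a \<odot> (b + c) = a \<odot> b + a \<odot> c"
    and mult_scale_left: "(r *s a) \<odot> b = r *s (a \<odot> b)"
    and mult_scale_right: "a \<odot> (r *s b) = r *s (a \<odot> b)"
    and star_add: "star (a + b) = star a + star b"
    and star_scale: "star (r *s a) = cnj r *s star a"
    and star_mult: "star (a \<odot> b) = star b \<odot> star a"
    and star_star [simp]: "star (star a) = a"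
    and carrier_subspace: "subspace carrier"
    and carrier_mult: "a \<in> carrier \<Longrightarrow> b \<in> carrier \<Longrightarrow> a \<odot> b \<in> carrier"
    and unit_carrier: "e \<in> carrier"
    and star_positive: "a \<in> carrier \<Longrightarrow> star a \<odot> a = 0 \<Longrightarrow> a = 0"
    and unit_left: "a \<in> carrier \<Longrightarrow> e \<odot> a = a"
    and unit_right: "a \<in> carrier \<Longrightarrow> a \<odot> e = a"
    and star_unit: "star e = e"
    and unit_nonzero: "e \<noteq> 0"
    and dimension_bound: "A \<subseteq> carrier \<Longrightarrow> independent A \<Longrightarrow> finite A \<and> card A \<le> D"
    and rank_bound: "P \<subseteq> carrier \<Longrightarrow> finite P \<Longrightarrow> 0 \<notin> P \<Longrightarrow> (\<And>p. p \<in> P \<Longrightarrow> p \<odot> p = p) \<Longrightarrow>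
      (\<And>p q. p \<in> P \<Longrightarrow> q \<in> P \<Longrightarrow> p \<noteq> q \<Longrightarrow> p \<odot> q = 0) \<Longrightarrow> card P \<le> N"
begin

lemma mult_zero_left [simp]: "0 \<odot> a = 0"
  using mult_add_left[of 0 0 a] by simp

lemma mult_zero_right [simp]: "a \<odot> 0 = 0"
  using mult_add_right[of a 0 0] by simp

lemma mult_minus_left: "(- a) \<odot> b = - (a \<odot> b)"
  using mult_add_left[of a "- a" b] by (simp add: add_eq_0_iff)

lemma mult_minus_right: "a \<odot> (- b) = - (a \<odot> b)"
  using mult_add_right[of a b "- b"] by (simp add: add_eq_0_iff)

lemma mult_diff_left: "(a - b) \<odot> c = a \<odot> c - b \<odot> c"
  using mult_add_left[of a "- b" c] by (simp add: mult_minus_left)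

lemma mult_diff_right: "a \<odot> (b - c) = a \<odot> b - a \<odot> c"
  using mult_add_right[of a b "- c"] by (simp add: mult_minus_right)

lemma mult_sum_left: "sum f A \<odot> b = (\<Sum>i\<in>A. f i \<odot> b)"
  by (induction A rule: infinite_finite_induct) (auto simp: mult_add_left)

lemma mult_sum_right: "b \<odot> sum f A = (\<Sum>i\<in>A. b \<odot> f i)"
  by (induction A rule: infinite_finite_induct) (auto simp: mult_add_right)

lemma star_zero [simp]: "star 0 = 0"
  using star_add[of 0 0] by simp

lemma star_diff: "star (a - b) = star a - star b"
  using star_add[of "a - b" b] by (simp add: algebra_simps)

lemma star_eq_0_iff [simp]: "star a = 0 \<longleftrightarrow> a = 0"
  by (metis star_star star_zero)

definition star_subalgebra :: "'r set \<Rightarrow> bool" where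
  "star_subalgebra B \<longleftrightarrow> subspace B \<and> B \<subseteq> carrier \<and> e \<in> B \<and>
     (\<forall>x\<in>B. \<forall>y\<in>B. x \<odot> y \<in> B) \<and> (\<forall>x\<in>B. star x \<in> B)"

lemma
  assumes "star_subalgebra B"
  shows subalgebra_subspace: "subspace B" and subalgebra_carrier: "x \<in> B \<Longrightarrow> x \<in> carrier"
    and subalgebra_unit: "e \<in> B" and subalgebra_mult: "x \<in> B \<Longrightarrow> y \<in> B \<Longrightarrow> x \<odot> y \<in> B"
    and subalgebra_star: "x \<in> B \<Longrightarrow> star x \<in> B"
    and subalgebra_add: "x \<in> B \<Longrightarrow> y \<in> B \<Longrightarrow> x + y \<in> B"
    and subalgebra_diff: "x \<in> B \<Longrightarrow> y \<in> B \<Longrightarrow> x - y \<in> B"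
    and subalgebra_scale: "x \<in> B \<Longrightarrow> c *s x \<in> B"
  using assms by (auto simp: star_subalgebra_def subspace_add subspace_diff subspace_scale)

text \<open>Otherwise \<open>w 0, ..., w D\<close> would be \<open>D + 1\<close> distinct
  independent elements, against \<open>dimension_bound\<close>. The case \<open>m = 0\<close> means
  \<open>w 0 = 0\<close>.\<close>

lemma sequence_dependent:
  assumes "\<And>m. m \<le> D \<Longrightarrow> w m \<in> carrier"
  shows "\<exists>m\<le>D. w m \<in> span (w ` {..<m})"
proof (rule ccontr)
  assume *: "\<not> ?thesis"
  have "independent (w ` {..<m}) \<and> card (w ` {..<m}) = m" if "m \<le> Suc D" for m
    using that
  proof (induction m)
    case 0
    then show ?case by (simp add: independent_empty)
  next
    case (Suc m)
    then have IH: "independent (w ` {..<m})" "card (w ` {..<m}) = m" by auto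
    have "w m \<notin> span (w ` {..<m})" using * Suc by auto
    then have "w m \<notin> w ` {..<m}" by (metis span_base)
    then show ?case
      using IH \<open>w m \<notin> span (w ` {..<m})\<close> by (simp add: lessThan_Suc independent_insertI)
  qed
  from this[of "Suc D"] dimension_bound[of "w ` {..<Suc D}"] assms show False
    by (auto simp: image_subset_iff)
qed

subsection \<open>Minimal projections\<close>

text \<open>Horner evaluation at \<open>h\<close> with \<open>q\<close> in the place of 1. For
  \<open>h\<close> in the corner of an idempotent \<open>q\<close> it is an algebra homomorphism
  into that corner.\<close>

definition poly_eval :: "'r \<Rightarrow> 'r \<Rightarrow> complex poly \<Rightarrow> 'r" where
  "poly_eval q h p = fold_coeffs (\<lambda>a r. a *s q + h \<odot> r) p 0"

context
  fixes q h :: 'r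
  assumes idem: "q \<odot> q = q" and qh: "q \<odot> h = h" and hq: "h \<odot> q = h"
begin

lemma poly_eval_0 [simp]: "poly_eval q h 0 = 0"
  by (simp add: poly_eval_def)

lemma poly_eval_pCons [simp]: "poly_eval q h (pCons a p) = a *s q + h \<odot> poly_eval q h p"
  by (cases "p = 0"; cases "a = 0") (auto simp: poly_eval_def)

lemma poly_eval_add: "poly_eval q h (p + r) = poly_eval q h p + poly_eval q h r"
  by (induction p r rule: poly_induct2)
    (auto simp: algebra_simps mult_add_right scale_left_distrib)

lemma poly_eval_smult: "poly_eval q h (smult c p) = c *s poly_eval q h p"
  by (induction p) (auto simp: scale_right_distrib mult_scale_right)

lemma poly_eval_diff: "poly_eval q h (p - r) = poly_eval q h p - poly_eval q h r"
  using poly_eval_add[of "p - r" r] by (simp add: algebra_simps)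

lemma poly_eval_unit_left: "q \<odot> poly_eval q h p = poly_eval q h p"
  by (induction p) (auto simp: mult_add_right mult_scale_right idem qh simp flip: mult_assoc)

lemma poly_eval_unit_right: "poly_eval q h p \<odot> q = poly_eval q h p"
  by (induction p) (auto simp: mult_add_left mult_scale_left idem mult_assoc)

lemma poly_eval_mult: "poly_eval q h (p * r) = poly_eval q h p \<odot> poly_eval q h r"
  by (induction p)
    (auto simp: mult_add_left mult_scale_left poly_eval_add poly_eval_smult mult_assoc
      poly_eval_unit_left)

lemma poly_eval_star:
  assumes "star q = q" "star h = h"
  shows "star (poly_eval q h p) = poly_eval q h (map_poly cnj p)"
proof -
  \<comment> \<open>The adjoint puts the factor \<open>h\<close> of the Horner form on the right, so
    it has to be moved back to the left.\<close>
  have comm: "poly_eval q h p \<odot> h = h \<odot> poly_eval q h p" for p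
    using poly_eval_mult[of p "[:0, 1:]"] poly_eval_mult[of "[:0, 1:]" p]
    by (simp add: hq mult.commute)
  show ?thesis
    by (induction p) (auto simp: star_add star_scale star_mult assms map_poly_pCons comm)
qed

lemma poly_eval_mem:
  assumes "subspace B" "\<And>x. x \<in> B \<Longrightarrow> h \<odot> x \<in> B" "q \<in> B"
  shows "poly_eval q h p \<in> B"
  by (induction p) (use assms in \<open>auto intro: subspace_add subspace_scale subspace_0\<close>)

lemma poly_eval_eigen:
  assumes "h \<odot> g = l *s g" "q \<odot> g = g"
  shows "poly_eval q h p \<odot> g = poly p l *s g"
  by (induction p)
    (auto simp: mult_add_left mult_scale_left assms mult_assoc mult_scale_right
      scale_left_distrib mult.commute)

text \<open>In finite dimension some power of \<open>h\<close> is a combination of lower ones, and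
  the difference is the value of a monic polynomial.\<close>

lemma annihilating_poly:
  assumes "\<And>p. poly_eval q h p \<in> carrier"
  obtains p where "p \<noteq> 0" "poly_eval q h p = 0"
proof -
  define w where "w m = poly_eval q h (monom 1 m)" for m
  obtain m where m: "w m \<in> span (w ` {..<m})"
    using sequence_dependent[of w] assms by (auto simp: w_def)
  \<comment> \<open>The values of polynomials of degree below \<open>m\<close>. Bounding the
    coefficients instead of the degree also covers \<open>m = 0\<close>, which leaves only the zero
    polynomial.\<close>
  define W where "W = poly_eval q h ` {r. \<forall>i\<ge>m. coeff r i = 0}"
  have "subspace W"
  proof (rule subspaceI)
    show "0 \<in> W" unfolding W_def by (rule image_eqI[of _ _ 0]) auto
    show "x + y \<in> W" if "x \<in> W" "y \<in> W" for x y
      using that unfolding W_def by (auto simp flip: poly_eval_add)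
    show "c *s x \<in> W" if "x \<in> W" for c x
      using that unfolding W_def by (auto simp flip: poly_eval_smult)
  qed
  moreover have "w ` {..<m} \<subseteq> W" by (auto simp: W_def w_def)
  ultimately have "span (w ` {..<m}) \<subseteq> W" by (rule span_minimal[rotated])
  with m obtain r where r: "\<forall>i\<ge>m. coeff r i = 0" "w m = poly_eval q h r"
    unfolding W_def by blast
  have "coeff (monom 1 m - r) m = 1" using r by simp
  then have "monom 1 m - r \<noteq> 0" by (metis coeff_0 zero_neq_one)
  moreover have "poly_eval q h (monom 1 m - r) = 0"
    using r(2) by (simp add: poly_eval_diff w_def)
  ultimately show ?thesis using that by blast
qed

end

text \<open>A root \<open>l\<close> of the minimal polynomial of \<open>h\<close> yields an
  eigenvector \<open>g\<close> that is itself a polynomial in \<open>h\<close>. Then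
  \<open>star g \<odot> g\<close>, suitably scaled, is a projection, and it differs from
  \<open>q\<close> because \<open>h\<close> is not scalar.\<close>

lemma hermitian_spectral_projection:
  assumes B: "star_subalgebra B" and q: "q \<in> B" "star q = q" "q \<odot> q = q"
    and h: "h \<in> B" "star h = h" "q \<odot> h = h" "h \<odot> q = h" "\<nexists>c. h = c *s q"
  obtains f where "f \<in> B" "star f = f" "f \<odot> f = f" "f \<noteq> 0" "f \<noteq> q" "q \<odot> f = f" "f \<odot> q = f"
proof -
  note qh = q(3) h(3) h(4)
  let ?ev = "poly_eval q h"
  have ev_B: "?ev p \<in> B" for p
    using poly_eval_mem[OF qh subalgebra_subspace[OF B]] subalgebra_mult[OF B h(1)] q(1) by blast
  obtain p0 where "p0 \<noteq> 0" "?ev p0 = 0"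
    using annihilating_poly[OF qh] subalgebra_carrier[OF B] ev_B by blast
  then obtain p where p: "p \<noteq> 0" "?ev p = 0"
    and least: "\<And>r. r \<noteq> 0 \<Longrightarrow> ?ev r = 0 \<Longrightarrow> degree p \<le> degree r"
    using ex_has_least_nat[of "\<lambda>p. p \<noteq> 0 \<and> ?ev p = 0" p0 degree] by blast
  have "q \<noteq> 0" using h(3,5) by (metis mult_zero_left scale_zero_left)
  \<comment> \<open>A nonzero constant polynomial takes the value \<open>a *s q\<close>, which is
    nonzero; so \<open>p\<close> is not constant and has a root.\<close>
  have "\<nexists>a r. a \<noteq> 0 \<and> r = 0 \<and> p = pCons a r"
    using p(2) \<open>q \<noteq> 0\<close> by (auto simp: poly_eval_pCons[OF qh] poly_eval_0[OF qh])
  then obtain l where "poly p l = 0" using fundamental_theorem_of_algebra_alt by blast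
  then obtain r where r: "p = [:-l, 1:] * r" by (metis dvdE poly_eq_0_iff_dvd)
  with p have "r \<noteq> 0" by auto
  then have "degree r < degree p"
    using degree_mult_eq[of "[:-l, 1:]" r] by (simp add: r)
  define g where "g = ?ev r"
  have "g \<noteq> 0" using least[of r] \<open>r \<noteq> 0\<close> \<open>degree r < degree p\<close> by (auto simp: g_def)
  have "?ev [:-l, 1:] = h - l *s q"
    by (simp add: poly_eval_pCons[OF qh] poly_eval_0[OF qh] h)
  then have "(h - l *s q) \<odot> g = 0"
    using p(2) poly_eval_mult[OF qh, of "[:-l, 1:]" r] by (metis r g_def)
  then have hg: "h \<odot> g = l *s g"
    by (simp add: mult_diff_left mult_scale_left g_def poly_eval_unit_left[OF qh])
  have qg: "q \<odot> g = g" by (simp add: g_def poly_eval_unit_left[OF qh])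
  note eigen = poly_eval_eigen[OF qh hg qg]
  \<comment> \<open>As \<open>star g\<close> is again a polynomial in \<open>h\<close>, it acts on
    the eigenvector \<open>g\<close> as a scalar, so \<open>k\<close> is a multiple of
    \<open>g\<close>.\<close>
  define k where "k = star g \<odot> g"
  have "k \<noteq> 0" using star_positive \<open>g \<noteq> 0\<close> subalgebra_carrier[OF B] ev_B unfolding k_def g_def by blast
  obtain c where c: "k = c *s g"
    using eigen[of "map_poly cnj r"] poly_eval_star[OF qh q(2) h(2), of r] by (auto simp: k_def g_def)
  have star_k: "star k = k" by (simp add: k_def star_mult)
  have kB: "k \<in> B" using c subalgebra_scale[OF B ev_B] by (simp add: g_def)
  \<comment> \<open>\<open>k\<close> is idempotent up to the factor \<open>d\<close>. Positivity
    makes \<open>d\<close> nonzero, and \<open>star k = k\<close> makes it real, so that dividing by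
    \<open>d\<close> gives a projection.\<close>
  define d where "d = c * poly r l"
  have kk: "k \<odot> k = d *s k"
    using eigen[of r] by (simp add: c d_def mult_scale_left mult_scale_right mult.commute flip: g_def)
  have "d \<noteq> 0" using star_positive[of k] kk star_k \<open>k \<noteq> 0\<close> subalgebra_carrier[OF B kB] by auto
  have "cnj d *s k = d *s k" using star_mult[of k k] by (simp add: kk star_scale star_k)
  then have d: "cnj d = d" using \<open>k \<noteq> 0\<close> by simp
  show ?thesis
  proof (rule that[of "inverse d *s k"])
    show "inverse d *s k \<in> B" using kB by (rule subalgebra_scale[OF B])
    show "star (inverse d *s k) = inverse d *s k" by (simp add: star_scale star_k d)
    show "inverse d *s k \<odot> inverse d *s k = inverse d *s k"
      using \<open>d \<noteq> 0\<close> by (simp add: mult_scale_left mult_scale_right kk)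
    show "inverse d *s k \<noteq> 0" using \<open>d \<noteq> 0\<close> \<open>k \<noteq> 0\<close> by simp
    show "q \<odot> inverse d *s k = inverse d *s k" by (simp add: mult_scale_right c qg)
    show "inverse d *s k \<odot> q = inverse d *s k"
      by (simp add: mult_scale_left c poly_eval_unit_right[OF qh] g_def)
    show "inverse d *s k \<noteq> q"
    proof
      assume *: "inverse d *s k = q"
      have "h = h \<odot> inverse d *s k" using h(4) * by simp
      also have "\<dots> = l *s q"
        by (simp add: mult_scale_right c hg ac_simps flip: *)
      finally show False using h(5) by blast
    qed
  qed
qed

text \<open>If the Hermitian and the skew part of \<open>q \<odot> x \<odot> q\<close> were both
  scalar in the corner, so would be their sum. Hence one of them, made Hermitian by a factor
  \<open>\<i>\<close> if need be, has a proper spectral projection.\<close>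

lemma split_projection:
  assumes B: "star_subalgebra B" and q: "q \<in> B" "star q = q" "q \<odot> q = q"
    and x: "x \<in> B" "\<nexists>c. q \<odot> x \<odot> q = c *s q"
  obtains f where "f \<in> B" "star f = f" "f \<odot> f = f" "f \<noteq> 0" "f \<noteq> q" "q \<odot> f = f" "f \<odot> q = f"
proof -
  define y where "y = q \<odot> x \<odot> q"
  have qq: "q \<odot> (q \<odot> z) = q \<odot> z" for z by (simp add: q(3) flip: mult_assoc)
  have y: "y \<in> B" "q \<odot> y = y" "y \<odot> q = y" "q \<odot> star y = star y" "star y \<odot> q = star y"
    using q x by (auto simp: y_def star_mult mult_assoc qq intro!: subalgebra_mult[OF B])
  note yB = y(1) subalgebra_star[OF B y(1)]
  have decomp: "2 *s y = (y + star y) - \<i> *s (\<i> *s (y - star y))"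
    by (simp add: scale_left_distrib[of 1 1, simplified])
  have "(\<nexists>c. y + star y = c *s q) \<or> (\<nexists>c. \<i> *s (y - star y) = c *s q)"
  proof (rule ccontr)
    assume "\<not> ?thesis"
    then obtain a b where "y + star y = a *s q" "\<i> *s (y - star y) = b *s q" by auto
    then have "2 *s y = (a - \<i> * b) *s q" unfolding decomp by (simp add: scale_left_diff_distrib)
    then have "(1/2) *s 2 *s y = (1/2) *s (a - \<i> * b) *s q" by metis
    then have "y = ((a - \<i> * b) / 2) *s q" by simp
    then show False using x(2) unfolding y_def by blast
  qed
  then consider "\<nexists>c. y + star y = c *s q" | "\<nexists>c. \<i> *s (y - star y) = c *s q" by blast
  then show ?thesis
  proof cases
    case 1
    have "y + star y \<in> B" "star (y + star y) = y + star y"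
      "q \<odot> (y + star y) = y + star y" "(y + star y) \<odot> q = y + star y"
      using yB y by (auto simp: subalgebra_add[OF B] star_add mult_add_left mult_add_right)
    from hermitian_spectral_projection[OF B q this 1] that show ?thesis by blast
  next
    case 2
    have "\<i> *s (y - star y) \<in> B" "star (\<i> *s (y - star y)) = \<i> *s (y - star y)"
      "q \<odot> \<i> *s (y - star y) = \<i> *s (y - star y)" "\<i> *s (y - star y) \<odot> q = \<i> *s (y - star y)"
      using yB y
      by (auto simp: subalgebra_diff[OF B] subalgebra_scale[OF B] star_diff star_scale
          mult_diff_left mult_diff_right mult_scale_left mult_scale_right scale_right_diff_distrib)
    from hermitian_spectral_projection[OF B q this 2] that show ?thesis by blast
  qed
qed

subsection \<open>Chains of subalgebras\<close>

definition resolution :: "'r set \<Rightarrow> bool" where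
  "resolution P \<longleftrightarrow> finite P \<and> 0 \<notin> P \<and> (\<Sum>p\<in>P. p) = e \<and> (\<forall>p\<in>P. star p = p \<and> p \<odot> p = p) \<and>
     (\<forall>p\<in>P. \<forall>q\<in>P. p \<noteq> q \<longrightarrow> p \<odot> q = 0)"

text \<open>Minimality of the projections is stated as one-dimensionality of their corners, the form
  in which it is used later.\<close>

definition frame :: "'r set \<Rightarrow> 'r set \<Rightarrow> bool" where
  "frame B P \<longleftrightarrow> resolution P \<and> P \<subseteq> B \<and> (\<forall>p\<in>P. \<forall>x\<in>B. \<exists>c. p \<odot> x \<odot> p = c *s p)"

text \<open>For minimal projections this is Murray-von Neumann equivalence; the classes correspond
  to the simple blocks of \<open>B\<close>.\<close>

definition linked :: "'r set \<Rightarrow> 'r \<Rightarrow> 'r \<Rightarrow> bool" where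
  "linked B p q \<longleftrightarrow> (\<exists>x\<in>B. p \<odot> x \<odot> q \<noteq> 0)"

definition link_class :: "'r set \<Rightarrow> 'r set \<Rightarrow> 'r \<Rightarrow> 'r set" where
  "link_class B P p = {q \<in> P. linked B p q}"

lemma
  assumes "resolution P"
  shows resolution_finite: "finite P" and resolution_nonzero: "p \<in> P \<Longrightarrow> p \<noteq> 0"
    and resolution_sum: "(\<Sum>p\<in>P. p) = e" and resolution_star: "p \<in> P \<Longrightarrow> star p = p"
    and resolution_idem: "p \<in> P \<Longrightarrow> p \<odot> p = p"
    and resolution_orthogonal: "p \<in> P \<Longrightarrow> q \<in> P \<Longrightarrow> p \<noteq> q \<Longrightarrow> p \<odot> q = 0"
  using assms by (auto simp: resolution_def)

lemma resolution_card:
  assumes "resolution P" "P \<subseteq> carrier"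
  shows "card P \<le> N"
  using assms by (intro rank_bound) (auto simp: resolution_def)

text \<open>Both parts of \<open>q\<close> lie under \<open>q\<close>, hence are orthogonal to the
  other members. A nonzero idempotent is not orthogonal to itself, so both parts are new and
  distinct, which gives the exact cardinality.\<close>

lemma resolution_split:
  assumes Q: "resolution Q" "q \<in> Q"
    and f: "star f = f" "f \<odot> f = f" "f \<noteq> 0" "f \<noteq> q" "q \<odot> f = f" "f \<odot> q = f"
  defines "Q' \<equiv> insert f (insert (q - f) (Q - {q}))"
  shows "resolution Q' \<and> card Q' = Suc (card Q)"
proof -
  note idem = resolution_idem[OF Q(1)] and orth = resolution_orthogonal[OF Q(1)]
  have fs: "f \<odot> s = 0" "s \<odot> f = 0" if "s \<in> Q - {q}" for s
  proof -
    have "f \<odot> s = f \<odot> (q \<odot> s)" "s \<odot> f = (s \<odot> q) \<odot> f" by (simp_all add: f mult_assoc flip: mult_assoc[of f q])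
    then show "f \<odot> s = 0" "s \<odot> f = 0" using orth Q(2) that by auto
  qed
  have gs: "(q - f) \<odot> s = 0" "s \<odot> (q - f) = 0" if "s \<in> Q - {q}" for s
    using fs[OF that] orth Q(2) that by (auto simp: mult_diff_left mult_diff_right)
  have qf: "f \<odot> (q - f) = 0" "(q - f) \<odot> f = 0" "(q - f) \<odot> (q - f) = q - f"
    using f idem[OF Q(2)] by (auto simp: mult_diff_left mult_diff_right)
  have nz: "q - f \<noteq> 0" using f(4) by simp
  have "f \<notin> Q - {q}" using fs f(2,3) by metis
  moreover have "q - f \<notin> Q - {q}" using gs qf(3) nz by metis
  moreover have "f \<noteq> q - f" using qf(1) f(2,3) by metis
  ultimately have new: "f \<notin> insert (q - f) (Q - {q})" "q - f \<notin> Q - {q}" by auto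
  have fin: "finite (Q - {q})" using resolution_finite[OF Q(1)] by simp
  have "(\<Sum>p\<in>Q'. p) = f + (q - f) + (\<Sum>p\<in>Q-{q}. p)" using new fin by (simp add: Q'_def)
  also have "\<dots> = e"
    using sum.remove[OF resolution_finite[OF Q(1)] Q(2), of "\<lambda>p. p"] resolution_sum[OF Q(1)] by simp
  finally have "(\<Sum>p\<in>Q'. p) = e" .
  moreover have "card Q' = Suc (card Q)"
    using new fin Q resolution_finite[OF Q(1)] card_gt_0_iff[of Q] by (auto simp: Q'_def)
  ultimately show ?thesis
    using fin nz f fs gs qf resolution_star[OF Q(1)] idem orth resolution_nonzero[OF Q(1), of 0] Q(2)
    unfolding resolution_def by (auto simp: Q'_def star_diff)
qed

text \<open>Among the resolutions in \<open>B\<close> refining \<open>P\<close>, whose sizes are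
  bounded by \<open>N\<close>, take a largest one. A member with a non-scalar corner could be split
  further.\<close>

lemma frame_refinement:
  assumes B: "star_subalgebra B" and P: "resolution P" "P \<subseteq> B"
  obtains Q where "frame B Q" "\<And>q. q \<in> Q \<Longrightarrow> \<exists>p\<in>P. p \<odot> q = q"
proof -
  \<comment> \<open>The equation \<open>p \<odot> q = q\<close> says that \<open>q\<close> lies
    under \<open>p\<close>.\<close>
  define G where "G Q \<longleftrightarrow> resolution Q \<and> Q \<subseteq> B \<and> (\<forall>q\<in>Q. \<exists>p\<in>P. p \<odot> q = q)" for Q
  have "G P" using P resolution_idem[OF P(1)] unfolding G_def by blast
  moreover have "\<forall>Q. G Q \<longrightarrow> card Q < Suc N"
    unfolding less_Suc_eq_le using resolution_card subalgebra_carrier[OF B] unfolding G_def by blast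
  ultimately have "\<exists>Q. G Q \<and> (\<forall>Q'. G Q' \<longrightarrow> card Q' \<le> card Q)"
    by (rule ex_has_greatest_nat)
  then obtain Q where Q: "G Q" and max: "\<And>Q'. G Q' \<Longrightarrow> card Q' \<le> card Q" by blast
  note res = Q[unfolded G_def, THEN conjunct1]
  have "\<exists>c. q \<odot> x \<odot> q = c *s q" if q: "q \<in> Q" and x: "x \<in> B" for q x
  proof (rule ccontr)
    assume *: "\<not> ?thesis"
    have qB: "q \<in> B" using Q q by (auto simp: G_def)
    obtain f where f: "f \<in> B" "star f = f" "f \<odot> f = f" "f \<noteq> 0" "f \<noteq> q" "q \<odot> f = f" "f \<odot> q = f"
      using split_projection[OF B qB resolution_star[OF res q] resolution_idem[OF res q] x *] by blast
    obtain p where p: "p \<in> P" "p \<odot> q = q" using Q q by (auto simp: G_def)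
    have "p \<odot> f = f" using p f(6) by (metis mult_assoc)
    then have "p \<odot> (q - f) = q - f" by (simp add: mult_diff_right p)
    let ?Q = "insert f (insert (q - f) (Q - {q}))"
    have split: "resolution ?Q" "card ?Q = Suc (card Q)"
      using resolution_split[OF res q f(2-)] by auto
    have "G ?Q"
      using split(1) Q f(1) subalgebra_diff[OF B qB f(1)] p(1) \<open>p \<odot> f = f\<close> \<open>p \<odot> (q - f) = q - f\<close>
      unfolding G_def by blast
    then show False using max split(2) by force
  qed
  then show ?thesis using that[of Q] Q unfolding G_def frame_def by blast
qed

section \<open>Linking as an equivalence relation on a frame\<close>

context
  fixes B P
  assumes B: "star_subalgebra B" and P: "frame B P"
begin

lemma
  shows frame_resolution: "resolution P" and frame_mem: "p \<in> P \<Longrightarrow> p \<in> B"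
    and frame_scalar: "p \<in> P \<Longrightarrow> x \<in> B \<Longrightarrow> \<exists>c. p \<odot> x \<odot> p = c *s p"
  using P by (auto simp: frame_def)

text \<open>The product lies in the corner of \<open>q\<close>, which is scalar, and is nonzero by
  positivity. This lets nonzero elements between minimal projections be cancelled.\<close>

lemma corner_star_mult:
  assumes "p \<in> P" "q \<in> P" "x \<in> B" "p \<odot> x \<odot> q \<noteq> 0"
  obtains c where "c \<noteq> 0" "star (p \<odot> x \<odot> q) \<odot> (p \<odot> x \<odot> q) = c *s q"
proof -
  define y where "y = p \<odot> x \<odot> q"
  have y: "y \<in> B" "star y \<in> B"
    using assms by (auto simp: y_def subalgebra_mult[OF B] subalgebra_star[OF B] frame_mem)
  have "y \<odot> q = y" using resolution_idem[OF frame_resolution assms(2)] by (simp add: y_def mult_assoc)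
  moreover from this have "q \<odot> star y = star y"
    using star_mult[of y q] resolution_star[OF frame_resolution assms(2)] by simp
  moreover obtain c where "q \<odot> (star y \<odot> y) \<odot> q = c *s q"
    using frame_scalar[OF assms(2) subalgebra_mult[OF B y(2,1)]] by blast
  ultimately have c: "star y \<odot> y = c *s q" by (metis mult_assoc)
  moreover have "c \<noteq> 0" using star_positive[OF subalgebra_carrier[OF B y(1)]] assms(4) c
    by (auto simp flip: y_def)
  ultimately show ?thesis using that by (simp add: y_def)
qed

lemma linked_refl: "p \<in> P \<Longrightarrow> linked B p p"
  unfolding linked_def
  using frame_mem resolution_idem[OF frame_resolution] resolution_nonzero[OF frame_resolution] by metis

lemma linked_sym:
  assumes "p \<in> P" "q \<in> P" "linked B p q"
  shows "linked B q p"
proof -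
  obtain x where x: "x \<in> B" "p \<odot> x \<odot> q \<noteq> 0" using assms by (auto simp: linked_def)
  have "star (p \<odot> x \<odot> q) = q \<odot> star x \<odot> p"
    using resolution_star[OF frame_resolution] assms by (simp add: star_mult mult_assoc)
  then show ?thesis using x subalgebra_star[OF B] unfolding linked_def by (metis star_eq_0_iff)
qed

text \<open>Multiplying \<open>p \<odot> x \<odot> q \<odot> y \<odot> r\<close> on the left by the
  adjoint of \<open>p \<odot> x \<odot> q\<close> leaves a nonzero multiple of
  \<open>q \<odot> y \<odot> r\<close>, so the product is nonzero.\<close>

lemma linked_trans:
  assumes "p \<in> P" "q \<in> P" "linked B p q" "linked B q r"
  shows "linked B p r"
proof -
  obtain x where x: "x \<in> B" "p \<odot> x \<odot> q \<noteq> 0" using assms by (auto simp: linked_def)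
  obtain y where y: "y \<in> B" "q \<odot> y \<odot> r \<noteq> 0" using assms by (auto simp: linked_def)
  obtain c where c: "c \<noteq> 0" "star (p \<odot> x \<odot> q) \<odot> (p \<odot> x \<odot> q) = c *s q"
    using corner_star_mult[OF assms(1,2) x] by blast
  have "(c *s q) \<odot> (y \<odot> r) \<noteq> 0" using c(1) y(2) by (simp add: mult_scale_left mult_assoc)
  then have "p \<odot> (x \<odot> q \<odot> y) \<odot> r \<noteq> 0"
    unfolding c(2)[symmetric] by (metis mult_assoc mult_zero_right)
  then show ?thesis
    using x(1) y(1) frame_mem[OF assms(2)] subalgebra_mult[OF B] unfolding linked_def by blast
qed

lemma link_class_eq_iff:
  assumes "p \<in> P" "q \<in> P"
  shows "link_class B P p = link_class B P q \<longleftrightarrow> linked B p q"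
  using assms linked_refl linked_sym linked_trans unfolding link_class_def by blast

end

text \<open>The Peirce decomposition: \<open>x\<close> is multiplied on both sides by the unit,
  written as the sum over \<open>P\<close>.\<close>

lemma frame_expand:
  assumes B: "star_subalgebra B" and P: "resolution P" and x: "x \<in> B"
  shows "x = (\<Sum>q\<in>P. \<Sum>p\<in>P. p \<odot> x \<odot> q)"
proof -
  have "x = (\<Sum>p\<in>P. p) \<odot> x \<odot> (\<Sum>q\<in>P. q)"
    using subalgebra_carrier[OF B x] by (simp add: resolution_sum[OF P] unit_left unit_right)
  then show ?thesis by (simp add: mult_sum_left mult_sum_right)
qed

text \<open>A nonzero \<open>p \<odot> y \<odot> q\<close> with \<open>y\<close> in \<open>B\<close>
  already spans the corner of \<open>B'\<close> between \<open>p\<close> and \<open>q\<close>.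
  Without new links every Peirce component of \<open>B'\<close> would thus lie in
  \<open>B\<close>.\<close>

lemma new_link:
  assumes B: "star_subalgebra B" "star_subalgebra B'" "B \<subset> B'" and P: "frame B P" "frame B' P"
  obtains p q where "p \<in> P" "q \<in> P" "linked B' p q" "\<not> linked B p q"
proof -
  have "\<exists>p\<in>P. \<exists>q\<in>P. linked B' p q \<and> \<not> linked B p q"
  proof (rule ccontr)
    assume *: "\<not> ?thesis"
    have "x \<in> B" if x: "x \<in> B'" for x
    proof -
      have "p \<odot> x \<odot> q \<in> B" if pq: "p \<in> P" "q \<in> P" for p q
      proof (cases "linked B p q")
        case False
        then have "p \<odot> x \<odot> q = 0" using * pq x by (auto simp: linked_def)
        then show ?thesis using subspace_0[OF subalgebra_subspace[OF B(1)]] by simp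
      next
        case True
        then obtain y where y: "y \<in> B" "p \<odot> y \<odot> q \<noteq> 0" by (auto simp: linked_def)
        define z where "z = p \<odot> y \<odot> q"
        have zB: "z \<in> B" using y pq frame_mem[OF B(1) P(1)] by (auto simp: z_def intro!: subalgebra_mult[OF B(1)])
        obtain c where c: "c \<noteq> 0" "star z \<odot> z = c *s q"
          using corner_star_mult[OF B(1) P(1) pq y] unfolding z_def by blast
        have pz: "star z \<odot> p = star z"
          using pq resolution_star[OF frame_resolution[OF B(1) P(1)]] resolution_idem[OF frame_resolution[OF B(1) P(1)]]
          by (simp add: z_def star_mult mult_assoc)
        have "x \<odot> q \<odot> star z \<in> B'"
          using x zB B(3) frame_mem[OF B(2) P(2) pq(2)]
          by (auto intro!: subalgebra_mult[OF B(2)] subalgebra_star[OF B(2)])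
        then obtain d where d: "p \<odot> (x \<odot> q \<odot> star z) \<odot> p = d *s p"
          using frame_scalar[OF B(2) P(2) pq(1)] by blast
        \<comment> \<open>Writing \<open>c *s q\<close> as \<open>star z \<odot> z\<close> exposes
          an element of the scalar corner of \<open>p\<close> in front of \<open>z\<close>, so
          \<open>p \<odot> x \<odot> q\<close> is a multiple of \<open>p \<odot> z\<close>.\<close>
        have "c *s (p \<odot> x \<odot> q) = p \<odot> x \<odot> q \<odot> (c *s q)"
          using resolution_idem[OF frame_resolution[OF B(1) P(1)] pq(2)] by (simp add: mult_scale_right mult_assoc)
        also have "\<dots> = p \<odot> (x \<odot> q \<odot> star z) \<odot> p \<odot> z"
          unfolding c(2)[symmetric] by (metis mult_assoc pz)
        also have "\<dots> = d *s (p \<odot> z)" by (simp add: d mult_scale_left)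
        finally have "inverse c *s c *s (p \<odot> x \<odot> q) = inverse c *s d *s (p \<odot> z)" by simp
        then have "p \<odot> x \<odot> q = inverse c *s d *s (p \<odot> z)" using c(1) by simp
        moreover have "inverse c *s d *s (p \<odot> z) \<in> B"
          using zB frame_mem[OF B(1) P(1) pq(1)] by (intro subalgebra_scale[OF B(1)] subalgebra_mult[OF B(1)])
        ultimately show ?thesis by metis
      qed
      then have "(\<Sum>q\<in>P. \<Sum>p\<in>P. p \<odot> x \<odot> q) \<in> B"
        by (intro subspace_sum[OF subalgebra_subspace[OF B(1)]])
      then show ?thesis
        using frame_expand[OF B(2) frame_resolution[OF B(2) P(2)] x] by metis
    qed
    then show False using B(3) by blast
  qed
  then show ?thesis using that by blast
qed

text \<open>With \<open>r\<close> projections and \<open>s\<close> link classes, the potential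
  \<open>r + (r - s)\<close> grows by at least one; the inequality is arranged to avoid subtraction
  of naturals. Neither \<open>r\<close> nor \<open>r - s\<close> drops under refinement. If
  \<open>r\<close> stays the same, the frame is unchanged and a new link merges two classes.\<close>

lemma chain_step:
  assumes B: "star_subalgebra B" "star_subalgebra B'" "B \<subset> B'" and P: "frame B P"
  obtains Q where "frame B' Q"
    "2 * card P + card (link_class B' Q ` Q) + 1 \<le> 2 * card Q + card (link_class B P ` P)"
proof -
  have resP: "resolution P" and PB': "P \<subseteq> B'" using P B(3) by (auto simp: frame_def)
  obtain Q where Q: "frame B' Q" "\<And>q. q \<in> Q \<Longrightarrow> \<exists>p\<in>P. p \<odot> q = q"
    using frame_refinement[OF B(2) resP PB'] by blast
  note resQ = frame_resolution[OF B(2) Q(1)]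
  note finP = resolution_finite[OF resP] and finQ = resolution_finite[OF resQ]
  \<comment> \<open>\<open>g q\<close> is a member of \<open>P\<close> above \<open>q\<close>; all
    other members annihilate \<open>q\<close>.\<close>
  obtain g where g: "\<And>q. q \<in> Q \<Longrightarrow> g q \<in> P" "\<And>q. q \<in> Q \<Longrightarrow> g q \<odot> q = q"
    using Q(2) by metis
  have off: "p \<odot> q = 0" if "p \<in> P" "q \<in> Q" "g q \<noteq> p" for p q
  proof -
    have "p \<odot> q = (p \<odot> g q) \<odot> q" using g(2)[OF that(2)] by (simp add: mult_assoc)
    then show ?thesis using resolution_orthogonal[OF resP that(1) g(1)[OF that(2)]] that(3) by simp
  qed
  have expand: "y = (\<Sum>q\<in>Q. y \<odot> q)" if "y \<in> B'" for y
    using unit_right[OF subalgebra_carrier[OF B(2) that]] by (simp add: resolution_sum[OF resQ] flip: mult_sum_right)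
  have "\<exists>q\<in>Q. g q = p" if p: "p \<in> P" for p
  proof (rule ccontr)
    assume "\<not> ?thesis"
    then have "(\<Sum>q\<in>Q. p \<odot> q) = 0" using off[OF p] by (intro sum.neutral) auto
    then show False using expand[of p] p PB' resolution_nonzero[OF resP p] by auto
  qed
  then have gQ: "g ` Q = P" using g(1) by blast
  \<comment> \<open>\<open>R\<close> holds one representative of each link class of \<open>P\<close>
    in \<open>B\<close>.\<close>
  obtain R where R: "R \<subseteq> P" "inj_on (link_class B P) R" "link_class B P ` P = link_class B P ` R"
    by (metis subset_image_inj subset_refl)
  have cardR: "card (link_class B P ` P) = card R" using R by (simp add: card_image)
  have rep: "\<exists>r\<in>R. linked B p r" if p: "p \<in> P" for p
  proof -
    obtain r where "r \<in> R" "link_class B P p = link_class B P r" using R(3) p by blast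
    then show ?thesis using link_class_eq_iff[OF B(1) P p] R(1) by blast
  qed
  \<comment> \<open>Links of \<open>B\<close> lift to the refinement. Since
    \<open>y \<odot> star y\<close> is a nonzero multiple of \<open>g q\<close>, the product
    \<open>q \<odot> y\<close> is nonzero, hence so is some \<open>q \<odot> y \<odot> q'\<close>;
    and \<open>y \<odot> r = y\<close> forces \<open>q'\<close> under \<open>r\<close>.\<close>
  have transfer: "\<exists>q'\<in>Q. g q' = r \<and> linked B' q q'" if q: "q \<in> Q" and r: "r \<in> P" "linked B (g q) r" for q r
  proof -
    have gq: "g q \<in> P" by (rule g(1)[OF q])
    obtain x where x: "x \<in> B" "r \<odot> x \<odot> g q \<noteq> 0"
      using linked_sym[OF B(1) P gq r] by (auto simp: linked_def)
    define y where "y = star (r \<odot> x \<odot> g q)"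
    have yB: "y \<in> B'"
      using x(1) r(1) gq PB' B(3) by (auto simp: y_def intro!: subalgebra_star[OF B(2)] subalgebra_mult[OF B(2)])
    obtain c where c: "c \<noteq> 0" "y \<odot> star y = c *s g q"
      using corner_star_mult[OF B(1) P r(1) gq x] by (auto simp: y_def)
    have "q \<odot> g q = q"
      using star_mult[of "g q" q] g(2)[OF q] resolution_star[OF resP gq] resolution_star[OF resQ q] by simp
    then have "q \<odot> (y \<odot> star y) = c *s q" by (simp add: c(2) mult_scale_right)
    moreover have "c *s q \<noteq> 0" using c(1) resolution_nonzero[OF resQ q] by simp
    ultimately have qy: "q \<odot> y \<noteq> 0" by (metis mult_assoc mult_zero_left)
    have "q \<odot> y = (\<Sum>q'\<in>Q. q \<odot> y \<odot> q')"
      using expand[OF yB] by (metis (no_types, lifting) mult_sum_right mult_assoc sum.cong)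
    then obtain q' where q': "q' \<in> Q" "q \<odot> y \<odot> q' \<noteq> 0" using qy by (metis sum.neutral)
    have "y \<odot> r = y" using resolution_star[OF resP r(1)] resolution_idem[OF resP r(1)]
      by (simp add: y_def star_mult mult_assoc)
    then have "g q' = r" using off[OF r(1) q'(1)] q'(2) by (metis mult_assoc mult_zero_right)
    then show ?thesis using q' yB unfolding linked_def by blast
  qed
  \<comment> \<open>By \<open>transfer\<close> every link class of \<open>Q\<close> meets
    \<open>A\<close>, so there are at most \<open>card A\<close> classes.\<close>
  define A where "A = {q \<in> Q. g q \<in> R}"
  have "link_class B' Q ` Q \<subseteq> link_class B' Q ` A"
  proof (rule image_subsetI)
    fix q assume q: "q \<in> Q"
    obtain r where r: "r \<in> R" "linked B (g q) r" using rep g(1) q by blast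
    then obtain q' where "q' \<in> Q" "g q' = r" "linked B' q q'" using transfer[OF q] R(1) by blast
    then show "link_class B' Q q \<in> link_class B' Q ` A"
      using link_class_eq_iff[OF B(2) Q(1) q] r(1) unfolding A_def by blast
  qed
  moreover have "finite A" using finQ by (simp add: A_def)
  ultimately have s'A: "card (link_class B' Q ` Q) \<le> card A"
    using card_mono[of "link_class B' Q ` A"] card_image_le[of A] by (meson finite_imageI le_trans)
  \<comment> \<open>Comparing the complements of \<open>R\<close> and \<open>A\<close> shows that
    \<open>r - s\<close> does not drop.\<close>
  have "P - R \<subseteq> g ` (Q - A)" using gQ by (auto simp: A_def)
  then have "card (P - R) \<le> card (Q - A)" using finQ by (meson finite_Diff surj_card_le)
  moreover have "card (P - R) = card P - card R" "card R \<le> card P"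
    using R(1) finP by (simp_all add: card_Diff_subset finite_subset card_mono)
  moreover have "card (Q - A) = card Q - card A" "card A \<le> card Q"
    using finQ by (simp_all add: A_def card_Diff_subset card_mono)
  ultimately have classes: "card (link_class B' Q ` Q) + card P \<le> card Q + card R" using s'A by linarith
  have "card P \<le> card Q" using gQ finQ card_image_le by blast
  then consider "card P < card Q" | "card P = card Q" by linarith
  then show ?thesis
  proof cases
    case 1
    then show ?thesis using that[OF Q(1)] classes cardR by linarith
  next
    case 2
    then have inj: "inj_on g Q" using gQ finQ by (metis eq_card_imp_inj_on)
    \<comment> \<open>As \<open>g\<close> is injective, only one term of the expansion of
      \<open>p\<close> along \<open>Q\<close> survives, and it equals both \<open>p\<close> and a
      member of \<open>Q\<close>.\<close>
    have "p \<in> Q" if p: "p \<in> P" for p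
    proof -
      obtain q where q: "q \<in> Q" "g q = p" using gQ p by blast
      have "p = (\<Sum>q'\<in>Q. p \<odot> q')" using expand p PB' by blast
      also have "\<dots> = p \<odot> q + (\<Sum>q'\<in>Q - {q}. p \<odot> q')" using finQ q(1) by (rule sum.remove)
      also have "(\<Sum>q'\<in>Q - {q}. p \<odot> q') = 0"
        using off[OF p] q inj by (intro sum.neutral) (auto simp: inj_on_def)
      finally show ?thesis using g(2)[OF q(1)] q by simp
    qed
    then have PQ: "P = Q" using 2 finQ by (simp add: card_subset_eq subsetI)
    note P' = Q(1)[folded PQ]
    obtain p q where pq: "p \<in> P" "q \<in> P" "linked B' p q" "\<not> linked B p q"
      using new_link[OF B P P'] by blast
    \<comment> \<open>The representatives of the newly linked \<open>p\<close> and \<open>q\<close>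
      differ, as their classes in \<open>B\<close> do, but fall into one class in \<open>B'\<close>.
      So fewer than \<open>card R\<close> classes remain.\<close>
    obtain r s where rs: "r \<in> R" "linked B p r" "s \<in> R" "linked B q s" using rep pq by metis
    have "r \<noteq> s"
      using rs pq linked_sym[OF B(1) P] linked_trans[OF B(1) P] R(1) by blast
    have mono: "linked B' x y" if "linked B x y" for x y using that B(3) by (auto simp: linked_def)
    have sub: "link_class B' P ` P \<subseteq> link_class B' P ` R"
    proof (rule image_subsetI)
      fix p assume p: "p \<in> P"
      obtain r where "r \<in> R" "linked B p r" using rep p by blast
      then show "link_class B' P p \<in> link_class B' P ` R"
        using link_class_eq_iff[OF B(2) P' p] R(1) mono by blast
    qed
    have "linked B' r s"
      using rs pq mono linked_sym[OF B(2) P'] linked_trans[OF B(2) P'] R(1) by (meson subsetD)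
    then have "link_class B' P r = link_class B' P s"
      using link_class_eq_iff[OF B(2) P'] rs R(1) by blast
    then have "\<not> inj_on (link_class B' P) R" using rs \<open>r \<noteq> s\<close> by (auto simp: inj_on_def)
    moreover have finR: "finite R" using R(1) finP finite_subset by blast
    ultimately have "card (link_class B' P ` R) < card R"
      using card_image_le[OF finR] eq_card_imp_inj_on[OF finR] by (metis le_neq_implies_less)
    moreover have "card (link_class B' P ` P) \<le> card (link_class B' P ` R)"
      using sub finR by (simp add: card_mono)
    ultimately show ?thesis using that[OF P'] cardR by simp
  qed
qed

text \<open>The potential \<open>2 * r - s\<close> is nonnegative at the start, since
  \<open>s \<le> r\<close>, and gains at least one per step. At the end \<open>r \<le> N\<close> and
  \<open>s \<ge> 1\<close>, which makes the bound strict.\<close>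

lemma chain_length:
  assumes "\<And>i. i \<le> m \<Longrightarrow> star_subalgebra (B i)" "\<And>i. i < m \<Longrightarrow> B i \<subset> B (Suc i)"
  shows "m < 2 * N"
proof -
  have ex: "\<exists>P. frame (B i) P \<and> card (link_class (B i) P ` P) + i \<le> 2 * card P" if "i \<le> m" for i
    using that
  proof (induction i)
    case 0
    have "resolution {e}" by (simp add: resolution_def unit_nonzero star_unit unit_left unit_carrier)
    then obtain P where P: "frame (B 0) P"
      using frame_refinement[OF assms(1)[OF 0]] subalgebra_unit[OF assms(1)[OF 0]] by blast
    then have "finite P" by (simp add: frame_def resolution_def)
    then show ?case using P card_image_le[of P "link_class (B 0) P"] by force
  next
    case (Suc i)
    then obtain P where P: "frame (B i) P" "card (link_class (B i) P ` P) + i \<le> 2 * card P" by auto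
    obtain Q where "frame (B (Suc i)) Q"
      "2 * card P + card (link_class (B (Suc i)) Q ` Q) + 1 \<le> 2 * card Q + card (link_class (B i) P ` P)"
      using chain_step[OF assms(1) assms(1) assms(2) P(1)] Suc.prems by auto
    then show ?case using P(2) by (intro exI[of _ Q]) linarith
  qed
  obtain P where P: "frame (B m) P" "card (link_class (B m) P ` P) + m \<le> 2 * card P" using ex by blast
  have res: "resolution P" and "P \<subseteq> carrier"
    using P(1) subalgebra_carrier[OF assms(1)[of m]] by (auto simp: frame_def)
  have "P \<noteq> {}" using resolution_sum[OF res] unit_nonzero by auto
  then have "0 < card (link_class (B m) P ` P)"
    using resolution_finite[OF res] by (simp add: card_gt_0_iff)
  then show ?thesis using P(2) resolution_card[OF res \<open>P \<subseteq> carrier\<close>] by linarith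
qed

subsection \<open>Generated subalgebras\<close>

definition word :: "'r list \<Rightarrow> 'r" where
  "word xs = foldr (\<odot>) xs e"

definition generated :: "'r set \<Rightarrow> 'r set" where
  "generated S = span (word ` lists S)"

lemma word_simps [simp]: "word [] = e" "word (x # xs) = x \<odot> word xs"
  by (simp_all add: word_def)

lemma word_carrier: "set xs \<subseteq> carrier \<Longrightarrow> word xs \<in> carrier"
  by (induction xs) (auto intro: unit_carrier carrier_mult)

lemma word_append:
  "set ys \<subseteq> carrier \<Longrightarrow> word (xs @ ys) = word xs \<odot> word ys"
  by (induction xs) (auto simp: mult_assoc unit_left word_carrier)

text \<open>Bilinearity: the right factor is extended to the span first, then the left one.\<close>

lemma span_mult_subset:
  assumes "x \<in> span A" "y \<in> span A'" "\<And>a b. a \<in> A \<Longrightarrow> b \<in> A' \<Longrightarrow> a \<odot> b \<in> W" "subspace W"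
  shows "x \<odot> y \<in> W"
proof -
  have "subspace {y. a \<odot> y \<in> W}" for a
    using assms(4) by (auto intro!: subspaceI simp: mult_add_right mult_scale_right subspace_0 subspace_add subspace_scale)
  then have *: "a \<odot> y \<in> W" if "a \<in> A" for a
    using span_minimal[of A' "{y. a \<odot> y \<in> W}"] assms(2,3) that by blast
  have "subspace {x. x \<odot> y \<in> W}"
    using assms(4) by (auto intro!: subspaceI simp: mult_add_left mult_scale_left subspace_0 subspace_add subspace_scale)
  then show ?thesis using span_minimal[of A "{x. x \<odot> y \<in> W}"] assms(1) * by blast
qed

text \<open>Concatenation of words gives closure under products. The adjoint of a word is the
  reversed word of adjoint letters, and \<open>S\<close> is closed under adjoints.\<close>

lemma generated_subalgebra:
  assumes S: "S \<subseteq> carrier" "\<And>x. x \<in> S \<Longrightarrow> star x \<in> S"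
  shows "star_subalgebra (generated S)"
proof -
  have words: "set xs \<subseteq> carrier" if "xs \<in> lists S" for xs using that S(1) by (auto simp: in_lists_conv_set)
  have "word ` lists S \<subseteq> carrier" using words word_carrier by blast
  then have "generated S \<subseteq> carrier"
    unfolding generated_def using carrier_subspace by (rule span_minimal)
  moreover have "e \<in> generated S"
    unfolding generated_def by (rule span_base) (rule image_eqI[of _ _ "[]"]; simp)
  moreover have "x \<odot> y \<in> generated S" if "x \<in> generated S" "y \<in> generated S" for x y
    using that unfolding generated_def
  proof (rule span_mult_subset)
    fix a b assume "a \<in> word ` lists S" "b \<in> word ` lists S"
    then obtain xs ys where xy: "xs \<in> lists S" "ys \<in> lists S" "a = word xs" "b = word ys" by blast
    then have "a \<odot> b = word (xs @ ys)" using word_append[OF words] by simp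
    moreover have "xs @ ys \<in> lists S" using xy by simp
    ultimately show "a \<odot> b \<in> span (word ` lists S)" by (intro span_base) blast
  qed simp
  moreover have "star x \<in> generated S" if "x \<in> generated S" for x
  proof -
    have star_word: "star (word xs) = word (rev (map star xs))" if "xs \<in> lists S" for xs
      using that
    proof (induction xs)
      case (Cons x xs)
      have x: "star x \<in> carrier" using Cons S by auto
      then show ?case using Cons by (simp add: star_mult word_append unit_right)
    qed (simp add: star_unit)
    have "subspace {x. star x \<in> generated S}"
      unfolding generated_def
      by (auto intro!: subspaceI simp: star_add star_scale span_zero span_add span_scale)
    moreover have "word ` lists S \<subseteq> {x. star x \<in> generated S}"
    proof (rule image_subsetI, rule CollectI)
      fix xs assume xs: "xs \<in> lists S"
      have "rev (map star xs) \<in> lists S" using xs S(2) by (auto simp: in_lists_conv_set)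
      then show "star (word xs) \<in> generated S"
        unfolding generated_def star_word[OF xs] by (intro span_base imageI)
    qed
    ultimately show ?thesis using span_minimal that unfolding generated_def by blast
  qed
  ultimately show ?thesis by (auto simp: star_subalgebra_def generated_def)
qed

text \<open>The spans of words of length at most \<open>j\<close> must stall at some
  \<open>j < D\<close>. From there on, prepending a letter does not leave the span, so longer words
  contribute nothing.\<close>

lemma generated_by_short_words:
  assumes S: "S \<subseteq> carrier"
  shows "generated S \<subseteq> span (word ` {xs \<in> lists S. length xs \<le> D})"
proof -
  define A where "A m = word ` {xs \<in> lists S. length xs \<le> m}" for m
  have A_mono: "A i \<subseteq> A j" if "i \<le> j" for i j using that by (auto simp: A_def)
  have "\<exists>j<D. A (Suc j) \<subseteq> span (A j)"
  proof (rule ccontr)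
    assume *: "\<not> ?thesis"
    then have "\<forall>j. \<exists>w. j < D \<longrightarrow> w \<in> A (Suc j) \<and> w \<notin> span (A j)" by blast
    then obtain v where v: "\<And>j. j < D \<Longrightarrow> v j \<in> A (Suc j)" "\<And>j. j < D \<Longrightarrow> v j \<notin> span (A j)" by metis
    \<comment> \<open>Without stalling, \<open>e\<close> and one new word at each of
      \<open>D\<close> levels give \<open>D + 1\<close> elements, each outside the span of its
      predecessors.\<close>
    define w where "w m = (case m of 0 \<Rightarrow> e | Suc j \<Rightarrow> v j)" for m
    have wA: "w m \<in> A m" if "m \<le> D" for m
    proof (cases m)
      case 0
      then show ?thesis by (auto simp: w_def A_def intro!: image_eqI[of _ _ "[]"])
    qed (use v that in \<open>auto simp: w_def\<close>)
    have "A m \<subseteq> carrier" for m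
      unfolding A_def using S word_carrier by (auto simp: in_lists_conv_set subset_iff)
    then obtain m where m: "m \<le> D" "w m \<in> span (w ` {..<m})"
      using sequence_dependent[of w] wA by blast
    show False
    proof (cases m)
      case 0
      then show ?thesis using m(2) unit_nonzero by (simp add: w_def)
    next
      case (Suc j)
      have "w ` {..<m} \<subseteq> A j"
      proof (rule image_subsetI)
        fix i assume "i \<in> {..<m}"
        then have "i \<le> j" using Suc by simp
        then show "w i \<in> A j" using wA[of i] A_mono[of i j] m(1) Suc by auto
      qed
      then have "w m \<in> span (A j)" using m(2) span_mono by blast
      then show ?thesis using v(2)[of j] Suc m(1) by (simp add: w_def)
    qed
  qed
  then obtain j where j: "j < D" "A (Suc j) \<subseteq> span (A j)" by blast
  have "word xs \<in> span (A j)" if "xs \<in> lists S" for xs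
    using that
  proof (induction xs)
    case Nil
    then show ?case by (auto simp: A_def intro!: span_base image_eqI[of _ _ "[]"])
  next
    case (Cons x xs)
    show ?case unfolding word_simps
    proof (rule span_mult_subset)
      show "x \<in> span {x}" by (simp add: span_base)
      fix a b assume "a \<in> {x}" "b \<in> A j"
      then obtain ys where ys: "a = x" "b = word ys" "ys \<in> lists S" "length ys \<le> j" by (auto simp: A_def)
      have "a \<odot> b \<in> A (Suc j)"
        using Cons ys by (auto simp: A_def intro!: image_eqI[of _ _ "x # ys"])
      then show "a \<odot> b \<in> span (A j)" using j(2) by blast
    qed (use Cons in auto)
  qed
  then have "generated S \<subseteq> span (A j)"
    unfolding generated_def by (intro span_minimal) auto
  also have "\<dots> \<subseteq> span (A D)" using j(1) by (intro span_mono A_mono) simp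
  finally show ?thesis by (simp add: A_def)
qed

text \<open>One step of the filtration multiplies two halves of a word, so the admissible length
  doubles. The second half may be empty, as the empty word is \<open>e\<close>.\<close>

lemma word_in_filtration:
  assumes "\<And>i. i \<le> L \<Longrightarrow> e \<in> S i" "S 0 \<subseteq> carrier"
    and "\<And>i x y. i < L \<Longrightarrow> x \<in> S i \<Longrightarrow> y \<in> S i \<Longrightarrow> x \<odot> y \<in> S (Suc i)"
  shows "j \<le> L \<Longrightarrow> set xs \<subseteq> S 0 \<Longrightarrow> length xs \<le> 2 ^ j \<Longrightarrow> word xs \<in> S j"
proof (induction j arbitrary: xs)
  case 0
  then consider "xs = []" | x where "xs = [x]" "x \<in> S 0"
    by (cases xs rule: remdups_adj.cases) auto
  then show ?case using assms(1)[of 0] assms(2) 0(1) by cases (auto simp: unit_right)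
next
  case (Suc j)
  let ?a = "take (2 ^ j) xs" and ?b = "drop (2 ^ j) xs"
  have "set ?a \<subseteq> S 0" "set ?b \<subseteq> S 0"
    using Suc.prems(2) set_take_subset set_drop_subset by (metis order_trans)+
  moreover have "length ?a \<le> 2 ^ j" "length ?b \<le> 2 ^ j" using Suc.prems(3) by auto
  ultimately have "word ?a \<odot> word ?b \<in> S (Suc j)"
    using assms(3)[of j] Suc.IH Suc.prems(1) by simp
  moreover have "word (?a @ ?b) = word ?a \<odot> word ?b"
    using \<open>set ?b \<subseteq> S 0\<close> assms(2) by (intro word_append) blast
  ultimately show ?case by simp
qed

text \<open>The algebra generated by \<open>S t\<close> is contained in \<open>S (t + L)\<close>,
  which is strictly below \<open>S (Suc (t + L))\<close>. Sampling every \<open>Suc L\<close> steps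
  hence gives a strict chain of subalgebras; \<open>2 * N\<close> such steps contradict
  \<open>chain_length\<close>.\<close>

lemma filtration_length:
  assumes sub: "\<And>t. t \<le> l \<Longrightarrow> subspace (S t)" and carr: "\<And>t. t \<le> l \<Longrightarrow> S t \<subseteq> carrier"
    and unit: "\<And>t. t \<le> l \<Longrightarrow> e \<in> S t" and star: "\<And>t x. t \<le> l \<Longrightarrow> x \<in> S t \<Longrightarrow> star x \<in> S t"
    and strict: "\<And>t. t < l \<Longrightarrow> S t \<subset> S (Suc t)"
    and prod: "\<And>t x y. t < l \<Longrightarrow> x \<in> S t \<Longrightarrow> y \<in> S t \<Longrightarrow> x \<odot> y \<in> S (Suc t)"
    and L: "D \<le> 2 ^ L"
  shows "l < 2 * N * Suc L"
proof (rule ccontr)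
  assume "\<not> ?thesis"
  then have l: "i * Suc L \<le> l" if "i \<le> 2 * N" for i
    using that mult_le_mono1[of i "2 * N" "Suc L"] by linarith
  have gen: "generated (S t) \<subseteq> S (t + L)" if t: "t + L \<le> l" for t
  proof -
    have "word xs \<in> S (t + L)" if "xs \<in> lists (S t)" "length xs \<le> D" for xs
      using word_in_filtration[of L "\<lambda>i. S (t + i)" L xs] unit carr[of t] prod t that L
      by (auto simp: subset_iff)
    then have "span (word ` {xs \<in> lists (S t). length xs \<le> D}) \<subseteq> S (t + L)"
      using sub[OF t] by (intro span_minimal) auto
    then show ?thesis using generated_by_short_words[OF carr[of t]] t by auto
  qed
  define B where "B i = generated (S (i * Suc L))" for i
  have "2 * N < 2 * N"
  proof (rule chain_length[of _ B])
    show "star_subalgebra (B i)" if "i \<le> 2 * N" for i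
      unfolding B_def using carr star l[OF that] by (intro generated_subalgebra) auto
    show "B i \<subset> B (Suc i)" if "i < 2 * N" for i
    proof -
      let ?t = "i * Suc L"
      have t: "Suc (?t + L) \<le> l" using l[of "Suc i"] that by simp
      have "B i \<subseteq> S (?t + L)" using gen[of ?t] t by (simp add: B_def)
      also have "\<dots> \<subset> S (Suc (?t + L))" using strict t by simp
      also have "\<dots> = S (Suc i * Suc L)" by (simp add: add.commute add.left_commute)
      also have "\<dots> \<subseteq> B (Suc i)"
      proof
        fix x assume x: "x \<in> S (Suc i * Suc L)"
        have "x \<in> carrier" using x carr[OF l[of "Suc i"]] that by auto
        then have "x = word [x]" by (simp add: unit_right)
        then show "x \<in> B (Suc i)" unfolding B_def generated_def
          using x by (metis Cons_in_lists_iff image_eqI lists.Nil span_base)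
      qed
      finally show ?thesis .
    qed
  qed
  then show False by simp
qed

end

subsection \<open>Block matrices\<close>

definition scale_fun :: "complex \<Rightarrow> ('i \<Rightarrow> complex) \<Rightarrow> 'i \<Rightarrow> complex" where
  "scale_fun c f = (\<lambda>i. c * f i)"

interpretation cfun: vector_space scale_fun
  by unfold_locales (auto simp: scale_fun_def fun_eq_iff algebra_simps)

lemma sum_fun_apply: "(\<Sum>a\<in>A. f a) i = (\<Sum>a\<in>A. f a i)"
  for f :: "'a \<Rightarrow> 'i \<Rightarrow> complex"
  by (induction A rule: infinite_finite_induct) auto

text \<open>All members of \<open>A\<close> lie in the span of the indicator functions of the points
  of \<open>X\<close>.\<close>

lemma independent_card_le_support:
  fixes A :: "('i \<Rightarrow> complex) set"
  assumes "finite X" "\<And>f i. f \<in> A \<Longrightarrow> i \<notin> X \<Longrightarrow> f i = 0" "cfun.independent A"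
  shows "finite A \<and> card A \<le> card X"
proof -
  define \<delta> :: "'i \<Rightarrow> 'i \<Rightarrow> complex" where "\<delta> x = (\<lambda>i. if i = x then 1 else 0)" for x
  have "f \<in> cfun.span (\<delta> ` X)" if "f \<in> A" for f
  proof -
    have "f = (\<Sum>x\<in>X. scale_fun (f x) (\<delta> x))"
    proof
      fix i
      have "(\<Sum>x\<in>X. scale_fun (f x) (\<delta> x)) i = (\<Sum>x\<in>X. if i = x then f x else 0)"
        unfolding sum_fun_apply by (intro sum.cong) (auto simp: scale_fun_def \<delta>_def)
      then show "f i = (\<Sum>x\<in>X. scale_fun (f x) (\<delta> x)) i" using assms(1,2) that by simp
    qed
    moreover have "(\<Sum>x\<in>X. scale_fun (f x) (\<delta> x)) \<in> cfun.span (\<delta> ` X)"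
      by (intro cfun.span_sum cfun.span_scale cfun.span_base) auto
    ultimately show ?thesis by simp
  qed
  then have "finite A \<and> card A \<le> card (\<delta> ` X)"
    using cfun.independent_span_bound[of "\<delta> ` X" A] assms by blast
  then show ?thesis using card_image_le[OF assms(1), of \<delta>] by linarith
qed

definition mat_mult ::
    "'i set \<Rightarrow> ('i \<times> 'i \<Rightarrow> complex) \<Rightarrow> ('i \<times> 'i \<Rightarrow> complex) \<Rightarrow> 'i \<times> 'i \<Rightarrow> complex" where
  "mat_mult X M M' = (\<lambda>(i, j). \<Sum>k\<in>X. M (i, k) * M' (k, j))"

definition mat_adjoint :: "('i \<times> 'i \<Rightarrow> complex) \<Rightarrow> 'i \<times> 'i \<Rightarrow> complex" where
  "mat_adjoint M = (\<lambda>(i, j). cnj (M (j, i)))"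

definition mat_unit :: "'i set \<Rightarrow> 'i \<times> 'i \<Rightarrow> complex" where
  "mat_unit X = (\<lambda>(i, j). if i = j \<and> i \<in> X then 1 else 0)"

definition supported_on :: "'i set \<Rightarrow> ('i \<Rightarrow> complex) set" where
  "supported_on E = {M. \<forall>a. a \<notin> E \<longrightarrow> M a = 0}"

text \<open>Nonzero columns of orthogonal idempotents, one for each, are linearly independent.\<close>

lemma orthogonal_idempotents_card_le:
  fixes P :: "('i \<times> 'i \<Rightarrow> complex) set"
  assumes X: "finite X" and P: "P \<subseteq> supported_on (X \<times> X)" "finite P" "0 \<notin> P"
    and idem: "\<And>p. p \<in> P \<Longrightarrow> mat_mult X p p = p"
    and orth: "\<And>p q. p \<in> P \<Longrightarrow> q \<in> P \<Longrightarrow> p \<noteq> q \<Longrightarrow> mat_mult X p q = 0"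
  shows "card P \<le> card X"
proof -
  have "\<exists>j i. p (i, j) \<noteq> 0" if "p \<in> P" for p
  proof (rule ccontr)
    assume "\<not> ?thesis"
    then have "p = 0" by (auto simp: fun_eq_iff)
    then show False using that P(3) by simp
  qed
  then obtain c where c: "\<And>p. p \<in> P \<Longrightarrow> \<exists>i. p (i, c p) \<noteq> 0" by metis
  define v where "v p = (\<lambda>i. p (i, c p))" for p
  have act: "(\<Sum>k\<in>X. p (i, k) * v q k) = (if p = q then v q i else 0)" if "p \<in> P" "q \<in> P" for p q i
  proof -
    have "(\<Sum>k\<in>X. p (i, k) * v q k) = mat_mult X p q (i, c q)" by (simp add: mat_mult_def v_def)
    then show ?thesis using idem orth that by (auto simp: v_def)
  qed
  have inj: "inj_on v P"
  proof (rule inj_onI, rule ccontr)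
    fix p q assume pq: "p \<in> P" "q \<in> P" "v p = v q" "p \<noteq> q"
    then have "v p i = 0" for i using act[OF pq(1,1), of i] act[OF pq(1,2), of i] by simp
    then show False using c[OF pq(1)] by (simp add: v_def)
  qed
  have "cfun.independent (v ` P)"
  proof
    assume "cfun.dependent (v ` P)"
    then obtain u where u: "\<exists>x\<in>v ` P. u x \<noteq> 0" "(\<Sum>x\<in>v ` P. scale_fun (u x) x) = 0"
      using cfun.dependent_finite[of "v ` P"] P(2) by auto
    then obtain p where p: "p \<in> P" "u (v p) \<noteq> 0" by blast
    have zero: "(\<Sum>q\<in>P. u (v q) * v q k) = 0" for k
      using fun_cong[OF u(2), of k] by (simp add: sum_fun_apply scale_fun_def sum.reindex[OF inj])
    have "u (v p) * v p i = 0" for i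
    proof -
      \<comment> \<open>Applying the matrix \<open>p\<close> to the dependence relation isolates the
        term of \<open>p\<close>.\<close>
      have "0 = (\<Sum>k\<in>X. p (i, k) * (\<Sum>q\<in>P. u (v q) * v q k))" by (simp add: zero)
      also have "\<dots> = (\<Sum>q\<in>P. u (v q) * (\<Sum>k\<in>X. p (i, k) * v q k))"
        unfolding sum_distrib_left by (subst sum.swap) (simp add: mult_ac)
      also have "\<dots> = (\<Sum>q\<in>P. if q = p then u (v p) * v p i else 0)"
        using act[OF p(1)] by (intro sum.cong) auto
      finally show ?thesis using P(2) p(1) by simp
    qed
    then show False using p c[OF p(1)] by (auto simp: v_def)
  qed
  moreover have "f i = 0" if "f \<in> v ` P" "i \<notin> X" for f i
    using that P(1) by (auto simp: v_def supported_on_def)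
  ultimately show ?thesis
    using independent_card_le_support[of X "v ` P"] X by (simp add: card_image[OF inj])
qed

text \<open>The blocks are the classes of \<open>E\<close>: transitivity keeps products within the
  support, and reflexivity admits the unit matrix.\<close>

lemma star_algebra_block_matrices:
  fixes X :: "'i set"
  assumes X: "finite X" "X \<noteq> {}" and E: "equiv X E"
  shows "star_algebra scale_fun (mat_mult X) mat_adjoint (mat_unit X) (supported_on E) (card E) (card X)"
proof -
  have EX: "E \<subseteq> X \<times> X" using E by (simp add: equiv_def refl_on_def)
  then have finE: "finite E" using X(1) finite_subset by blast
  have in_X: "i \<in> X \<and> j \<in> X" if "M \<in> supported_on E" "M (i, j) \<noteq> 0" for M :: "'i \<times> 'i \<Rightarrow> complex" and i j
    using that EX by (auto simp: supported_on_def)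
  show ?thesis
  proof unfold_locales
    fix a b c :: "'i \<times> 'i \<Rightarrow> complex" and r :: complex
    show "mat_mult X (mat_mult X a b) c = mat_mult X a (mat_mult X b c)"
      unfolding mat_mult_def fun_eq_iff
      by (auto simp: sum_distrib_left sum_distrib_right mult.assoc intro: sum.swap)
    show "mat_mult X (a + b) c = mat_mult X a c + mat_mult X b c"
      by (simp add: mat_mult_def fun_eq_iff algebra_simps sum.distrib)
    show "mat_mult X a (b + c) = mat_mult X a b + mat_mult X a c"
      by (simp add: mat_mult_def fun_eq_iff algebra_simps sum.distrib)
    show "mat_mult X (scale_fun r a) b = scale_fun r (mat_mult X a b)"
      by (simp add: mat_mult_def scale_fun_def fun_eq_iff sum_distrib_left mult.assoc)
    show "mat_mult X a (scale_fun r b) = scale_fun r (mat_mult X a b)"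
      by (simp add: mat_mult_def scale_fun_def fun_eq_iff sum_distrib_left mult.left_commute)
    show "mat_adjoint (a + b) = mat_adjoint a + mat_adjoint b"
      by (simp add: mat_adjoint_def fun_eq_iff)
    show "mat_adjoint (scale_fun r a) = scale_fun (cnj r) (mat_adjoint a)"
      by (simp add: mat_adjoint_def scale_fun_def fun_eq_iff)
    show "mat_adjoint (mat_mult X a b) = mat_mult X (mat_adjoint b) (mat_adjoint a)"
      by (simp add: mat_adjoint_def mat_mult_def fun_eq_iff mult.commute)
    show "mat_adjoint (mat_adjoint a) = a"
      by (simp add: mat_adjoint_def fun_eq_iff)
    show "cfun.subspace (supported_on E)"
      by (rule cfun.subspaceI) (auto simp: supported_on_def scale_fun_def)
    show "mat_mult X a b \<in> supported_on E" if "a \<in> supported_on E" "b \<in> supported_on E"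
      unfolding supported_on_def
    proof clarify
      fix i j assume "(i, j) \<notin> E"
      then have "(i, k) \<notin> E \<or> (k, j) \<notin> E" for k using E by (metis equivE transD)
      then have "a (i, k) * b (k, j) = 0" for k using that unfolding supported_on_def by fastforce
      then show "mat_mult X a b (i, j) = 0"
        unfolding mat_mult_def prod.case by (intro sum.neutral) blast
    qed
    show "mat_unit X \<in> supported_on E"
      using E by (auto simp: supported_on_def mat_unit_def equiv_def refl_on_def)
    show "a = 0" if a: "a \<in> supported_on E" "mat_mult X (mat_adjoint a) a = 0"
    proof -
      have "a (i, j) = 0" for i j
      proof (rule ccontr)
        assume nz: "a (i, j) \<noteq> 0"
        \<comment> \<open>The diagonal entry at \<open>j\<close> of the product is the squared norm
          of column \<open>j\<close>.\<close>
        have "(\<Sum>k\<in>X. complex_of_real ((cmod (a (k, j)))\<^sup>2)) = 0"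
          using fun_cong[OF a(2), of "(j, j)"]
          unfolding complex_norm_square by (simp add: mat_mult_def mat_adjoint_def mult.commute)
        then have "(\<Sum>k\<in>X. (cmod (a (k, j)))\<^sup>2) = 0"
          by (simp del: of_real_power flip: of_real_sum)
        then show False using nz in_X[OF a(1) nz] X(1) by (simp add: sum_nonneg_eq_0_iff)
      qed
      then show ?thesis by (auto simp: fun_eq_iff)
    qed
    show "mat_mult X (mat_unit X) a = a" if "a \<in> supported_on E"
    proof -
      have "mat_mult X (mat_unit X) a (i, j) = (\<Sum>k\<in>X. if i = k then a (i, j) else 0)" for i j
        unfolding mat_mult_def mat_unit_def by (auto intro!: sum.cong)
      then show ?thesis using in_X[OF that] X(1) by (auto simp: fun_eq_iff)
    qed
    show "mat_mult X a (mat_unit X) = a" if "a \<in> supported_on E"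
    proof -
      have "mat_mult X a (mat_unit X) (i, j) = (\<Sum>k\<in>X. if k = j then a (i, j) else 0)" for i j
        unfolding mat_mult_def mat_unit_def by (auto intro!: sum.cong)
      then show ?thesis using in_X[OF that] X(1) by (auto simp: fun_eq_iff)
    qed
    show "mat_adjoint (mat_unit X) = mat_unit X"
      by (auto simp: mat_adjoint_def mat_unit_def fun_eq_iff)
    show "mat_unit X \<noteq> 0" using X(2) by (auto simp: mat_unit_def fun_eq_iff)
    show "finite A \<and> card A \<le> card E" if "A \<subseteq> supported_on E" "cfun.independent A" for A
      using independent_card_le_support[OF finE] that by (auto simp: supported_on_def)
    show "card P \<le> card X"
      if "P \<subseteq> supported_on E" "finite P" "0 \<notin> P" "\<And>p. p \<in> P \<Longrightarrow> mat_mult X p p = p"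
        "\<And>p q. p \<in> P \<Longrightarrow> q \<in> P \<Longrightarrow> p \<noteq> q \<Longrightarrow> mat_mult X p q = 0" for P
    proof (rule orthogonal_idempotents_card_le[OF X(1) _ that(2-)])
      show "P \<subseteq> supported_on (X \<times> X)" using that(1) EX by (auto simp: supported_on_def)
    qed
  qed
qed

subsection \<open>Colorings as spaces of matrices\<close>

text \<open>Here \<open>m\<close> stands for \<open>k - 2\<close>. Each common prefix
  \<open>u\<close> gives one block, with rows and columns indexed by the last coordinate.\<close>

definition last_pairs :: "'a set \<Rightarrow> nat \<Rightarrow> ('a list \<times> 'a list) set" where
  "last_pairs V m = {(u @ [a], u @ [b]) | u a b. u \<in> nlists m V \<and> a \<in> V \<and> b \<in> V}"

definition join :: "'a list \<times> 'a list \<Rightarrow> 'a list" where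
  "join xy = fst xy @ [last (snd xy)]"

definition color_matrices ::
    "'a set \<Rightarrow> nat \<Rightarrow> ('a list \<Rightarrow> 'c) \<Rightarrow> ('a list \<times> 'a list \<Rightarrow> complex) set" where
  "color_matrices V m \<chi> = {M \<in> supported_on (last_pairs V m).
     \<forall>x\<in>last_pairs V m. \<forall>y\<in>last_pairs V m. \<chi> (join x) = \<chi> (join y) \<longrightarrow> M x = M y}"

lemma join_snoc [simp]: "join (u @ [a], u' @ [b]) = u @ [a, b]"
  by (simp add: join_def)

lemma snoc_in_nlists_iff [simp]: "u @ [a] \<in> nlists (Suc m) V \<longleftrightarrow> u \<in> nlists m V \<and> a \<in> V"
  unfolding nlists_def by auto

lemma nlists_snocE:
  assumes "x \<in> nlists (Suc m) V"
  obtains u a where "x = u @ [a]" "u \<in> nlists m V" "a \<in> V"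
  using assms unfolding nlists_def by (cases x rule: rev_cases) auto

lemma snoc2_in_nlists_iff [simp]:
  "u @ [a, b] \<in> nlists (Suc (Suc m)) V \<longleftrightarrow> u \<in> nlists m V \<and> a \<in> V \<and> b \<in> V"
  unfolding nlists_def by auto

lemma last_pairsE:
  assumes "x \<in> last_pairs V m"
  obtains u a b where "x = (u @ [a], u @ [b])" "u \<in> nlists m V" "a \<in> V" "b \<in> V"
  using assms by (auto simp: last_pairs_def)

lemma last_pairs_snoc [simp]:
  "(u @ [a], u' @ [b]) \<in> last_pairs V m \<longleftrightarrow> u' = u \<and> u \<in> nlists m V \<and> a \<in> V \<and> b \<in> V"
  by (auto simp: last_pairs_def)

text \<open>Matrix positions within the blocks thus correspond to \<open>k\<close>-tuples, which
  makes the dimension bound \<open>n ^ k\<close> and lets every color class appear as a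
  matrix.\<close>

lemma bij_betw_join: "bij_betw join (last_pairs V m) (nlists (Suc (Suc m)) V)"
  unfolding bij_betw_def
proof
  show "inj_on join (last_pairs V m)" by (rule inj_onI) (auto elim!: last_pairsE)
  show "join ` last_pairs V m = nlists (Suc (Suc m)) V"
  proof
    show "join ` last_pairs V m \<subseteq> nlists (Suc (Suc m)) V" by (auto elim!: last_pairsE)
    show "nlists (Suc (Suc m)) V \<subseteq> join ` last_pairs V m"
    proof
      fix v assume "v \<in> nlists (Suc (Suc m)) V"
      then obtain u a b where "v = u @ [a, b]" "u \<in> nlists m V" "a \<in> V" "b \<in> V"
        by (auto elim!: nlists_snocE)
      then show "v \<in> join ` last_pairs V m" by (intro image_eqI[of _ _ "(u @ [a], u @ [b])"]) auto
    qed
  qed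
qed

lemma
  assumes "finite V"
  shows finite_nlists: "finite (nlists m V)" and card_nlists: "card (nlists m V) = card V ^ m"
proof -
  have "nlists m V = {xs. set xs \<subseteq> V \<and> length xs = m}" unfolding nlists_def by blast
  then show "finite (nlists m V)" "card (nlists m V) = card V ^ m"
    using finite_lists_length_eq[OF assms, of m] card_lists_length_eq[OF assms, of m] by simp_all
qed

lemma equiv_last_pairs: "equiv (nlists (Suc m) V) (last_pairs V m)"
proof (rule equivI)
  show "last_pairs V m \<subseteq> nlists (Suc m) V \<times> nlists (Suc m) V" by (auto simp: last_pairs_def)
  show "refl_on (nlists (Suc m) V) (last_pairs V m)"
    by (auto simp: refl_on_def elim!: nlists_snocE)
  show "sym (last_pairs V m)" by (rule symI) (auto simp: last_pairs_def)
  show "trans (last_pairs V m)" by (rule transI) (auto simp: last_pairs_def)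
qed

section \<open>Closure properties and strict growth of the color spaces\<close>

lemma color_matricesI:
  assumes "\<And>x. x \<notin> last_pairs V m \<Longrightarrow> M x = 0"
    and "\<And>x y. x \<in> last_pairs V m \<Longrightarrow> y \<in> last_pairs V m \<Longrightarrow> \<chi> (join x) = \<chi> (join y) \<Longrightarrow> M x = M y"
  shows "M \<in> color_matrices V m \<chi>"
  using assms unfolding color_matrices_def supported_on_def by blast

lemma
  assumes "M \<in> color_matrices V m \<chi>"
  shows color_matrices_support: "x \<notin> last_pairs V m \<Longrightarrow> M x = 0"
    and color_matrices_eq: "x \<in> last_pairs V m \<Longrightarrow> y \<in> last_pairs V m \<Longrightarrow> \<chi> (join x) = \<chi> (join y) \<Longrightarrow> M x = M y"
  using assms unfolding color_matrices_def supported_on_def by blast+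

lemma color_matrices_subspace: "cfun.subspace (color_matrices V m \<chi>)"
proof (rule cfun.subspaceI)
  show "0 \<in> color_matrices V m \<chi>" by (rule color_matricesI) auto
  fix M M' c assume M: "M \<in> color_matrices V m \<chi>"
  then show "scale_fun c M \<in> color_matrices V m \<chi>"
    unfolding scale_fun_def
    by (intro color_matricesI) (simp add: color_matrices_support, metis color_matrices_eq)
  assume "M' \<in> color_matrices V m \<chi>"
  with M show "M + M' \<in> color_matrices V m \<chi>"
    unfolding plus_fun_def
    by (intro color_matricesI) (simp add: color_matrices_support, metis color_matrices_eq)
qed

text \<open>Diagonal positions are the tuples whose last two entries agree, a property that the
  color determines.\<close>

lemma color_matrices_unit:
  assumes "compatible_with_equality V (Suc (Suc m)) \<chi>"
  shows "mat_unit (nlists (Suc m) V) \<in> color_matrices V m \<chi>"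
proof -
  let ?I = "mat_unit (nlists (Suc m) V)"
  show ?thesis
  proof (rule color_matricesI)
    show "?I x = 0" if "x \<notin> last_pairs V m" for x
      using that by (cases x) (auto simp: mat_unit_def elim!: nlists_snocE)
    fix x y assume xy: "x \<in> last_pairs V m" "y \<in> last_pairs V m" "\<chi> (join x) = \<chi> (join y)"
    obtain u a b where x: "x = (u @ [a], u @ [b])" "u \<in> nlists m V" "a \<in> V" "b \<in> V"
      using xy(1) by (rule last_pairsE)
    obtain w c d where y: "y = (w @ [c], w @ [d])" "w \<in> nlists m V" "c \<in> V" "d \<in> V"
      using xy(2) by (rule last_pairsE)
    have "\<chi> (u @ [a, b]) = \<chi> (w @ [c, d])" using xy(3) by (simp add: x y)
    then have "(u @ [a, b]) ! m = (u @ [a, b]) ! Suc m \<longleftrightarrow> (w @ [c, d]) ! m = (w @ [c, d]) ! Suc m"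
      using assms x y unfolding compatible_with_equality_def
      by (metis snoc2_in_nlists_iff lessI less_SucI)
    then have "a = b \<longleftrightarrow> c = d" using x y by (simp add: nth_append)
    then show "?I x = ?I y" using x y by (simp add: mat_unit_def)
  qed
qed

text \<open>The adjoint at \<open>uab\<close> is the conjugate of the entry at \<open>uba\<close>,
  and exchanging the last two positions is a shuffle.\<close>

lemma color_matrices_adjoint:
  assumes "shufflable V (Suc (Suc m)) \<chi>" and M: "M \<in> color_matrices V m \<chi>"
  shows "mat_adjoint M \<in> color_matrices V m \<chi>"
proof -
  define \<pi> where "\<pi> i = (if i = m then Suc m else if i = Suc m then m else i)" for i
  have swap: "map (\<lambda>i. (u @ [a, b]) ! \<pi> i) [0..<Suc (Suc m)] = u @ [b, a]" if "u \<in> nlists m V" for u a b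
    using that by (intro nth_equalityI) (auto simp: \<pi>_def nth_append less_Suc_eq)
  have \<pi>: "\<pi> \<in> {..<Suc (Suc m)} \<rightarrow> {..<Suc (Suc m)}" by (auto simp: \<pi>_def)
  show ?thesis
  proof (rule color_matricesI)
    show "mat_adjoint M x = 0" if "x \<notin> last_pairs V m" for x
    proof -
      obtain y z where x: "x = (y, z)" by fastforce
      have "(z, y) \<notin> last_pairs V m" using that by (auto simp: x elim!: last_pairsE)
      then show ?thesis using color_matrices_support[OF M] by (simp add: x mat_adjoint_def)
    qed
    fix x y assume xy: "x \<in> last_pairs V m" "y \<in> last_pairs V m" "\<chi> (join x) = \<chi> (join y)"
    obtain u a b where x: "x = (u @ [a], u @ [b])" "u \<in> nlists m V" "a \<in> V" "b \<in> V"
      using xy(1) by (rule last_pairsE)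
    obtain w c d where y: "y = (w @ [c], w @ [d])" "w \<in> nlists m V" "c \<in> V" "d \<in> V"
      using xy(2) by (rule last_pairsE)
    have "\<chi> (u @ [b, a]) = \<chi> (w @ [d, c])"
      using assms(1)[unfolded shufflable_def, rule_format, OF \<pi>, of "u @ [a, b]" "w @ [c, d]"] x y xy(3)
      unfolding swap[OF x(2)] swap[OF y(2)] by simp
    then have "M (u @ [b], u @ [a]) = M (w @ [d], w @ [c])"
      using x y by (intro color_matrices_eq[OF M]) auto
    then show "mat_adjoint M x = mat_adjoint M y" by (simp add: mat_adjoint_def x y)
  qed
qed

text \<open>Having entries as a function of the color itself allows a matrix product to be read off
  from a multiset of colors.\<close>

lemma color_matrices_factor:
  assumes "M \<in> color_matrices V m \<chi>"
  obtains F where "\<And>x. x \<in> last_pairs V m \<Longrightarrow> M x = F (\<chi> (join x))"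
proof -
  define F where "F c = M (SOME x. x \<in> last_pairs V m \<and> \<chi> (join x) = c)" for c
  have "M x = F (\<chi> (join x))" if "x \<in> last_pairs V m" for x
  proof -
    have "(SOME y. y \<in> last_pairs V m \<and> \<chi> (join y) = \<chi> (join x)) \<in> last_pairs V m \<and>
        \<chi> (join (SOME y. y \<in> last_pairs V m \<and> \<chi> (join y) = \<chi> (join x))) = \<chi> (join x)"
      by (rule someI[of _ x]) (simp add: that)
    then show ?thesis unfolding F_def using color_matrices_eq[OF assms that] by metis
  qed
  then show ?thesis using that by blast
qed

text \<open>The entry of the product at \<open>uab\<close> sums over \<open>w\<close> the products
  of entries at \<open>uaw\<close> and \<open>uwb\<close>. These tuples arise from
  \<open>uab\<close> by replacing one of the last two entries by \<open>w\<close>, so the sum is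
  determined by the refined color.\<close>

lemma color_matrices_mult:
  assumes V: "finite V" and ref: "refines V (Suc (Suc m)) \<chi>' (wl_refinement V (Suc (Suc m)) \<chi>)"
    and M: "M \<in> color_matrices V m \<chi>" "M' \<in> color_matrices V m \<chi>"
  shows "mat_mult (nlists (Suc m) V) M M' \<in> color_matrices V m \<chi>'"
proof -
  let ?X = "nlists (Suc m) V"
  obtain F where F: "\<And>x. x \<in> last_pairs V m \<Longrightarrow> M x = F (\<chi> (join x))"
    using color_matrices_factor[OF M(1)] by blast
  obtain G where G: "\<And>x. x \<in> last_pairs V m \<Longrightarrow> M' x = G (\<chi> (join x))"
    using color_matrices_factor[OF M(2)] by blast
  have supp: "M (x, y) = 0" "M' (x, y) = 0" if "(x, y) \<notin> last_pairs V m" for x y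
    using color_matrices_support M that by blast+
  have eval: "mat_mult ?X M M' (u @ [a], u @ [b]) =
      sum_mset (image_mset (\<lambda>l. F (l ! Suc m) * G (l ! m)) (snd (wl_refinement V (Suc (Suc m)) \<chi> (u @ [a, b]))))"
    if u: "u \<in> nlists m V" "a \<in> V" "b \<in> V" for u a b
  proof -
    have [simp]: "length u = m" using u by simp
    have inj: "inj_on (\<lambda>w. u @ [w]) V" by (auto simp: inj_on_def)
    \<comment> \<open>The block structure leaves only middle indices with the prefix
      \<open>u\<close>.\<close>
    have off: "M (u @ [a], z) = 0" if z: "z \<in> ?X" "z \<notin> (\<lambda>w. u @ [w]) ` V" for z
    proof -
      obtain w c where "z = w @ [c]" "c \<in> V" using z(1) by (rule nlists_snocE)
      then show ?thesis using z(2) by (intro supp) auto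
    qed
    have "mat_mult ?X M M' (u @ [a], u @ [b]) = (\<Sum>z\<in>?X. M (u @ [a], z) * M' (z, u @ [b]))"
      by (simp add: mat_mult_def)
    also have "\<dots> = (\<Sum>z\<in>(\<lambda>w. u @ [w]) ` V. M (u @ [a], z) * M' (z, u @ [b]))"
  
      using u finite_nlists[OF V] off by (intro sum.mono_neutral_right) auto
    also have "\<dots> = (\<Sum>w\<in>V. M (u @ [a], u @ [w]) * M' (u @ [w], u @ [b]))"
      by (simp add: sum.reindex[OF inj])
    also have "\<dots> = (\<Sum>w\<in>V. F (\<chi> (u @ [a, w])) * G (\<chi> (u @ [w, b])))"
      using u by (intro sum.cong) (auto simp: F G)
    also have "\<dots> = (\<Sum>w\<in>V. F (\<chi> ((u @ [a, b])[Suc m := w])) * G (\<chi> ((u @ [a, b])[m := w])))"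
      by (simp add: list_update_append)
    also have "\<dots> = sum_mset (image_mset (\<lambda>l. F (l ! Suc m) * G (l ! m))
        (snd (wl_refinement V (Suc (Suc m)) \<chi> (u @ [a, b]))))"
      by (simp add: wl_refinement_def sum_unfold_sum_mset nth_append multiset.map_comp comp_def del: upt_Suc)
    finally show ?thesis .
  qed
  show ?thesis
  proof (rule color_matricesI)
    show "mat_mult ?X M M' x = 0" if "x \<notin> last_pairs V m" for x
    proof -
      obtain y y' where x: "x = (y, y')" by fastforce
      have "(y, z) \<notin> last_pairs V m \<or> (z, y') \<notin> last_pairs V m" for z
        using that equiv_last_pairs[of m V] unfolding x by (metis equivE transD)
      then have "M (y, z) * M' (z, y') = 0" for z using supp by (metis mult_eq_0_iff)
      then show ?thesis unfolding x mat_mult_def prod.case by (intro sum.neutral) blast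
    qed
    fix x y assume xy: "x \<in> last_pairs V m" "y \<in> last_pairs V m" "\<chi>' (join x) = \<chi>' (join y)"
    obtain u a b where x: "x = (u @ [a], u @ [b])" "u \<in> nlists m V" "a \<in> V" "b \<in> V"
      using xy(1) by (rule last_pairsE)
    obtain w c d where y: "y = (w @ [c], w @ [d])" "w \<in> nlists m V" "c \<in> V" "d \<in> V"
      using xy(2) by (rule last_pairsE)
    have "wl_refinement V (Suc (Suc m)) \<chi> (u @ [a, b]) = wl_refinement V (Suc (Suc m)) \<chi> (w @ [c, d])"
      using ref[unfolded refines_def, rule_format, of "u @ [a, b]" "w @ [c, d]"] x y xy(3) by simp
    then show "mat_mult ?X M M' x = mat_mult ?X M M' y"
      using eval[OF x(2-)] eval[OF y(2-)] x(1) y(1) by metis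
  qed
qed

lemma color_matrices_strict:
  assumes "strictly_refines V (Suc (Suc m)) \<chi>' \<chi>"
  shows "color_matrices V m \<chi> \<subset> color_matrices V m \<chi>'"
proof
  have join_mem: "join x \<in> nlists (Suc (Suc m)) V" if "x \<in> last_pairs V m" for x
    using bij_betwE[OF bij_betw_join] that by blast
  have ref: "refines V (Suc (Suc m)) \<chi>' \<chi>" "\<not> refines V (Suc (Suc m)) \<chi> \<chi>'"
    using assms by (auto simp: strictly_refines_def equivalent_colorings_def)
  show "color_matrices V m \<chi> \<subseteq> color_matrices V m \<chi>'"
    using ref(1) join_mem unfolding color_matrices_def refines_def by blast
  obtain v w where vw: "v \<in> nlists (Suc (Suc m)) V" "w \<in> nlists (Suc (Suc m)) V" "\<chi> v = \<chi> w" "\<chi>' v \<noteq> \<chi>' w"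
    using ref(2) by (auto simp: refines_def)
  obtain x where x: "x \<in> last_pairs V m" "join x = v" using bij_betw_join vw(1) by (metis bij_betw_iff_bijections)
  obtain y where y: "y \<in> last_pairs V m" "join y = w" using bij_betw_join vw(2) by (metis bij_betw_iff_bijections)
  \<comment> \<open>The indicator of the new color class of \<open>v\<close>. It separates
    \<open>v\<close> from \<open>w\<close>, which the old coloring does not.\<close>
  define M :: "'a list \<times> 'a list \<Rightarrow> complex"
    where "M z = (if z \<in> last_pairs V m \<and> \<chi>' (join z) = \<chi>' v then 1 else 0)" for z
  have "M \<in> color_matrices V m \<chi>'" by (rule color_matricesI) (auto simp: M_def)
  moreover have "M x \<noteq> M y" using x y vw by (auto simp: M_def)
  then have "M \<notin> color_matrices V m \<chi>" using x y vw color_matrices_eq by metis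
  ultimately show "color_matrices V m \<chi> \<noteq> color_matrices V m \<chi>'" by blast
qed

section \<open>Length of a chain of colorings, explicitly and asymptotically\<close>

lemma refinement_chain_length:
  fixes \<chi> :: "nat \<Rightarrow> 'a list \<Rightarrow> 'c"
  assumes V: "finite V" "V \<noteq> {}"
    and comp: "\<And>t. t \<le> l \<Longrightarrow> shufflable V (Suc (Suc m)) (\<chi> t) \<and> compatible_with_equality V (Suc (Suc m)) (\<chi> t)"
    and wl: "\<And>t. t < l \<Longrightarrow> refines V (Suc (Suc m)) (\<chi> (Suc t)) (wl_refinement V (Suc (Suc m)) (\<chi> t))"
    and strict: "\<And>t. t < l \<Longrightarrow> strictly_refines V (Suc (Suc m)) (\<chi> (Suc t)) (\<chi> t)"
    and L: "card V ^ Suc (Suc m) \<le> 2 ^ L"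
  shows "l < 2 * card V ^ Suc m * Suc L"
proof -
  let ?X = "nlists (Suc m) V" and ?E = "last_pairs V m"
  have X: "finite ?X" "?X \<noteq> {}" using V nlists_not_empty[of V "Suc m"] by (auto simp: finite_nlists)
  have cardE: "card ?E = card V ^ Suc (Suc m)"
    using bij_betw_same_card[OF bij_betw_join] V(1) card_nlists by metis
  interpret star_algebra scale_fun "mat_mult ?X" mat_adjoint "mat_unit ?X" "supported_on ?E" "card ?E" "card ?X"
    using X equiv_last_pairs by (rule star_algebra_block_matrices)
  have "l < 2 * card ?X * Suc L"
  \<comment> \<open>The color spaces form the filtration, with \<open>n ^ (k - 1)\<close> as the
    size of the matrices and \<open>n ^ k\<close> as the dimension bound.\<close>
  proof (rule filtration_length[of l "\<lambda>t. color_matrices V m (\<chi> t)"])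
    show "color_matrices V m (\<chi> t) \<subseteq> supported_on ?E" for t by (auto simp: color_matrices_def)
    show "card ?E \<le> 2 ^ L" using L cardE by simp
    show "color_matrices V m (\<chi> t) \<subset> color_matrices V m (\<chi> (Suc t))" if "t < l" for t
      using color_matrices_strict strict that by blast
    show "mat_mult ?X M M' \<in> color_matrices V m (\<chi> (Suc t))"
      if "t < l" "M \<in> color_matrices V m (\<chi> t)" "M' \<in> color_matrices V m (\<chi> t)" for t M M'
      using color_matrices_mult[OF V(1) wl] that by blast
  qed (use comp in \<open>auto simp: color_matrices_subspace color_matrices_unit color_matrices_adjoint\<close>)
  then show ?thesis using V(1) by (simp add: card_nlists)
qed

text \<open>The principal filter makes this one uniform constant for all
  \<open>k, n \<ge> 2\<close>. There \<open>k log n \<ge> 2\<close>, so the rounded factor is at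
  most \<open>2 k log n\<close>, which gives the constant 4. For \<open>n = 1\<close> the logarithm
  vanishes while the left side does not.\<close>

lemma bound_bigo:
  "(\<lambda>(k, n). real_of_int (2 * int n ^ (k - 1) * (\<lceil>real k * log 2 (real n)\<rceil> + 1)))
     \<in> O[principal ({2..} \<times> {2..})](\<lambda>(k, n). real k * real n ^ (k - 1) * log 2 (real n))"
proof (rule bigoI[of _ 4], unfold eventually_principal, rule ballI)
  fix kn :: "nat \<times> nat" assume "kn \<in> {2..} \<times> {2..}"
  then obtain k n where kn: "kn = (k, n)" "k \<in> {2..}" "n \<in> {2..}" by blast
  have log: "1 \<le> log 2 (real n)" using kn by simp
  then have "2 * 1 \<le> real k * log 2 (real n)" using kn by (intro mult_mono) auto
  moreover have "real_of_int \<lceil>real k * log 2 (real n)\<rceil> \<le> real k * log 2 (real n) + 1" by linarith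
  moreover have "real k * log 2 (real n) \<le> real_of_int \<lceil>real k * log 2 (real n)\<rceil>" by linarith
  ultimately have "\<bar>real_of_int \<lceil>real k * log 2 (real n)\<rceil> + 1\<bar> \<le> 2 * (real k * log 2 (real n))" by linarith
  then have "2 * real n ^ (k - 1) * \<bar>real_of_int \<lceil>real k * log 2 (real n)\<rceil> + 1\<bar>
      \<le> 2 * real n ^ (k - 1) * (2 * (real k * log 2 (real n)))"
    by (intro mult_left_mono) auto
  then show "norm (case kn of (k, n) \<Rightarrow> real_of_int (2 * int n ^ (k - 1) * (\<lceil>real k * log 2 (real n)\<rceil> + 1)))
      \<le> 4 * norm (case kn of (k, n) \<Rightarrow> real k * real n ^ (k - 1) * log 2 (real n))"
    unfolding kn(1) prod.case using log by (simp add: abs_mult mult_ac)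
qed

theorem theorem3p2:
  fixes V :: "'a set" and k n l :: nat and \<chi> :: "nat \<Rightarrow> 'a list \<Rightarrow> 'c"
  assumes "k \<ge> 2" and "finite V" and "n = card V"
    and "\<And>t. t \<in> {0..l} \<Longrightarrow> shufflable V k (\<chi> t) \<and> compatible_with_equality V k (\<chi> t)"
    and "\<And>t. t \<in> {1..l} \<Longrightarrow> refines V k (\<chi> t) (wl_refinement V k (\<chi> (t - 1)))"
    and "\<And>t. t \<in> {1..l} \<Longrightarrow> strictly_refines V k (\<chi> t) (\<chi> (t - 1))"
  shows "int l \<le> 2 * int n ^ (k - 1) * (\<lceil>real k * log 2 (real n)\<rceil> + 1)
    \<and> (\<lambda>(k, n). real_of_int (2 * int n ^ (k - 1) * (\<lceil>real k * log 2 (real n)\<rceil> + 1)))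
           \<in> O[principal ({2..} \<times> {2..})](\<lambda>(k, n). real k * real n ^ (k - 1) * log 2 (real n))"
proof (rule conjI[OF _ bound_bigo])
  obtain m where k: "k = Suc (Suc m)" using \<open>k \<ge> 2\<close> by (metis add_2_eq_Suc le_Suc_ex)
  show "int l \<le> 2 * int n ^ (k - 1) * (\<lceil>real k * log 2 (real n)\<rceil> + 1)"
  proof (cases "V = {}")
    case True
    \<comment> \<open>The right side vanishes for \<open>n = 0\<close> because
      \<open>k - 1 \<ge> 1\<close>. There are no tuples, so no coloring strictly refines
      another.\<close>
    have "l = 0"
    proof (rule ccontr)
      assume "l \<noteq> 0"
      then have "strictly_refines V k (\<chi> 1) (\<chi> 0)" using assms(6)[of 1] by simp
      then show False
        using True by (auto simp: k nlists_Suc strictly_refines_def equivalent_colorings_def refines_def)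
    qed
    then show ?thesis using True by (simp add: k assms(3))
  next
    case False
    then have n: "1 \<le> n" using assms(2,3) by (simp add: Suc_le_eq card_gt_0_iff)
    \<comment> \<open>The least natural exponent with \<open>n ^ k \<le> 2 ^ L\<close>; since
      \<open>n \<ge> 1\<close> the logarithm is nonnegative and \<open>nat\<close> loses
      nothing.\<close>
    define L where "L = nat \<lceil>real k * log 2 (real n)\<rceil>"
    have log: "0 \<le> real k * log 2 (real n)" using n by simp
    have "real n ^ k = (2 powr log 2 (real n)) powr real k" using n by (simp add: powr_realpow)
    also have "\<dots> = 2 powr (real k * log 2 (real n))" by (simp add: powr_powr mult.commute)
    also have "\<dots> \<le> 2 powr real L" unfolding L_def by (intro powr_mono) linarith+
    also have "\<dots> = real (2 ^ L)" by (simp add: powr_realpow)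
    finally have L: "card V ^ Suc (Suc m) \<le> 2 ^ L"
      by (metis assms(3) k of_nat_le_iff of_nat_power)
    have "l < 2 * card V ^ Suc m * Suc L"
    proof (rule refinement_chain_length[OF assms(2) False _ _ _ L])
      fix t
      show "shufflable V (Suc (Suc m)) (\<chi> t) \<and> compatible_with_equality V (Suc (Suc m)) (\<chi> t)"
        if "t \<le> l"
        using assms(4)[of t] that by (simp add: k)
      show "refines V (Suc (Suc m)) (\<chi> (Suc t)) (wl_refinement V (Suc (Suc m)) (\<chi> t))" if "t < l"
        using assms(5)[of "Suc t"] that by (simp add: k)
      show "strictly_refines V (Suc (Suc m)) (\<chi> (Suc t)) (\<chi> t)" if "t < l"
        using assms(6)[of "Suc t"] that by (simp add: k)
    qed
    then have "int l < int (2 * n ^ (k - 1) * Suc L)" unfolding k assms(3) diff_Suc_1 of_nat_less_iff .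
    then have "int l < 2 * int n ^ (k - 1) * (int L + 1)" by (simp add: algebra_simps)
    moreover have "int L = \<lceil>real k * log 2 (real n)\<rceil>" using log by (simp add: L_def)
    ultimately show ?thesis by simp
  qed
qed

end
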